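(* Let $X$ be a Banach space. The quantities $\beta_w(\cdot)$, $\operatorname{wck}(\cdot)$, $\omega(\cdot)$, $\chi(\cdot)$ (considered on bounded subsets of $X$) are equivalent if and only if $X$ enjoys the quantitative Schur property.
   Context: $X$ is a real or complex Banach space, canonically embedded in its bidual $X^{**}$. Two quantities defined on bounded subsets of $X$ are equivalent if each is bounded above by a constant multiple of the other, with constants independent of the set; several quantities are equivalent if they are pairwise equivalent. For nonempty sets, $\operatorname{dist}(A,B)=\inf\{\|a-b\|: a\in A,b\in B\}$ and $\widehat{\operatorname{d}}(A,B)=\sup\{\operatorname{dist}(a,B): a\in A\}$. For a bounded sequence put $\operatorname{ca}(x_n)=\inf_{n}\operatorname{diam}\{x_k: k\ge n\}$ (also for scalar sequences), $\delta(x_n)=\sup\{\operatorname{ca}(x^*(x_n)): x^*\in B_{X^*}\}$, $\widetilde\delta(x_n)=\inf\{\delta(x_{n_k}): (n_k)\text{ strictly increasing}\}$, and let $\operatorname{clust}_{w^*}(x_n)$ be the set of weak$^*$-cluster points of $(x_n)$ in $X^{**}$. For nonempty bounded $A\subset X$: $\chi(A)=\inf\{\widehat{\operatorname{d}}(A,F): F\subset X\text{ finite}\}$; $\omega(A)=\inf\{\widehat{\operatorname{d}}(A,K): K\subset X\text{ weakly compact}\}$; $\operatorname{wck}(A)=\sup\{\operatorname{dist}(\operatorname{clust}_{w^*}(x_n),X): (x_n)\text{ a sequence in }A\}$; $\beta_w(A)=\sup\{\widetilde\delta(x_n): (x_n)\text{ a sequence in }A\}$. $X$ has the $c$-Schur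 property if $\operatorname{ca}(x_n)\le c\,\delta(x_n)$ for each bounded sequence $(x_n)$ in $X$; it has the quantitative Schur property if it has the $c$-Schur property for some $c\ge0$. *)

theory Defs
  imports "HOL-Analysis.Analysis"
begin

text \<open>
  The library has no type class of complex Banach spaces. A Banach space over
  \<open>'k\<close> (used for \<open>'k = real\<close> and \<open>'k = complex\<close>) is a type of class \<open>banach\<close>
  together with a scalar multiplication by \<open>'k\<close> that extends the real one and for
  which the given norm is homogeneous.
\<close>

locale normed_scaling = vector_space smul
  for smul :: "'k::real_normed_field \<Rightarrow> 'a::banach \<Rightarrow> 'a" +
  assumes norm_smul: "norm (smul c x) = norm c * norm x"
    and smul_of_real: "smul (of_real r) x = r *\<^sub>R x"

lemma normed_scaling_scaleR: "normed_scaling (scaleR :: real \<Rightarrow> 'a::banach \<Rightarrow> 'a)"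
  by unfold_locales (simp_all add: algebra_simps)

lemma normed_scaling_complex: "normed_scaling ((*) :: complex \<Rightarrow> complex \<Rightarrow> complex)"
  by unfold_locales (simp_all add: algebra_simps norm_mult scaleR_conv_of_real)


section \<open>Dual and bidual\<close>

definition dual_space :: "('k::real_normed_field \<Rightarrow> 'a::banach \<Rightarrow> 'a) \<Rightarrow> ('a \<Rightarrow> 'k) set" where
  "dual_space smul = {f. bounded_linear f \<and> (\<forall>c x. f (smul c x) = c * f x)}"

definition dual_ball :: "('k::real_normed_field \<Rightarrow> 'a::banach \<Rightarrow> 'a) \<Rightarrow> ('a \<Rightarrow> 'k) set" where
  "dual_ball smul = {f \<in> dual_space smul. onorm f \<le> 1}"

text \<open>
  Elements of the bidual are functions on the dual, made unique as HOL functions by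
  the value \<open>undefined\<close> outside \<open>dual_space smul\<close>.
\<close>

definition bidual ::
  "('k::real_normed_field \<Rightarrow> 'a::banach \<Rightarrow> 'a) \<Rightarrow> (('a \<Rightarrow> 'k) \<Rightarrow> 'k) set" where
  "bidual smul = {\<phi> \<in> extensional (dual_space smul).
     (\<forall>f \<in> dual_space smul. \<forall>g \<in> dual_space smul. \<phi> (\<lambda>x. f x + g x) = \<phi> f + \<phi> g) \<and>
     (\<forall>c. \<forall>f \<in> dual_space smul. \<phi> (\<lambda>x. c * f x) = c * \<phi> f) \<and>
     (\<exists>C. \<forall>f \<in> dual_space smul. norm (\<phi> f) \<le> C * onorm f)}"

definition bidual_dist ::
  "('k::real_normed_field \<Rightarrow> 'a::banach \<Rightarrow> 'a) \<Rightarrow> (('a \<Rightarrow> 'k) \<Rightarrow> 'k) \<Rightarrow> (('a \<Rightarrow> 'k) \<Rightarrow> 'k) \<Rightarrow> real" where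
  "bidual_dist smul \<phi> \<psi> = (SUP f \<in> dual_ball smul. norm (\<phi> f - \<psi> f))"

definition canonical_embedding ::
  "('k::real_normed_field \<Rightarrow> 'a::banach \<Rightarrow> 'a) \<Rightarrow> 'a \<Rightarrow> ('a \<Rightarrow> 'k) \<Rightarrow> 'k" where
  "canonical_embedding smul x = restrict (\<lambda>f. f x) (dual_space smul)"

definition bidual_setdist ::
  "('k::real_normed_field \<Rightarrow> 'a::banach \<Rightarrow> 'a) \<Rightarrow> (('a \<Rightarrow> 'k) \<Rightarrow> 'k) set \<Rightarrow> (('a \<Rightarrow> 'k) \<Rightarrow> 'k) set \<Rightarrow> real" where
  "bidual_setdist smul A B = (INF (\<phi>, \<psi>) \<in> A \<times> B. bidual_dist smul \<phi> \<psi>)"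

definition weak_star_topology ::
  "('k::real_normed_field \<Rightarrow> 'a::banach \<Rightarrow> 'a) \<Rightarrow> (('a \<Rightarrow> 'k) \<Rightarrow> 'k) topology" where
  "weak_star_topology smul =
     subtopology (product_topology (\<lambda>_. euclidean) (dual_space smul)) (bidual smul)"

definition weak_topology ::
  "('k::real_normed_field \<Rightarrow> 'a::banach \<Rightarrow> 'a) \<Rightarrow> 'a topology" where
  "weak_topology smul =
     pullback_topology UNIV (canonical_embedding smul)
       (product_topology (\<lambda>_. euclidean) (dual_space smul))"

definition weak_star_cluster_points ::
  "('k::real_normed_field \<Rightarrow> 'a::banach \<Rightarrow> 'a) \<Rightarrow> (nat \<Rightarrow> 'a) \<Rightarrow> (('a \<Rightarrow> 'k) \<Rightarrow> 'k) set" where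
  "weak_star_cluster_points smul x = {\<phi> \<in> bidual smul.
     \<forall>U. openin (weak_star_topology smul) U \<and> \<phi> \<in> U \<longrightarrow>
       (\<exists>\<^sub>F n in sequentially. canonical_embedding smul (x n) \<in> U)}"


section \<open>Quantities attached to bounded sequences\<close>

definition ca :: "(nat \<Rightarrow> 'b::metric_space) \<Rightarrow> real" where
  "ca x = (INF n. diameter (x ` {n..}))"

definition delta :: "('k::real_normed_field \<Rightarrow> 'a::banach \<Rightarrow> 'a) \<Rightarrow> (nat \<Rightarrow> 'a) \<Rightarrow> real" where
  "delta smul x = (SUP f \<in> dual_ball smul. ca (\<lambda>n. f (x n)))"

definition delta_tilde :: "('k::real_normed_field \<Rightarrow> 'a::banach \<Rightarrow> 'a) \<Rightarrow> (nat \<Rightarrow> 'a) \<Rightarrow> real" where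
  "delta_tilde smul x = (INF r \<in> {r :: nat \<Rightarrow> nat. strict_mono r}. delta smul (x \<circ> r))"


section \<open>Measures of noncompactness of nonempty bounded sets\<close>

definition d_hat :: "'a::metric_space set \<Rightarrow> 'a set \<Rightarrow> real" where
  "d_hat A B = (SUP a \<in> A. infdist a B)"

text \<open>
  The finite and weakly compact sets below are required to be nonempty because
  \<open>infdist a {} = 0\<close> in the library, whereas the distance to the empty set should be infinite.
  All quantities are real-valued: for nonempty bounded arguments the suprema and infima
  range over nonempty bounded families (weak* cluster points exist by Banach-Alaoglu), so
  the conventions for \<open>Sup\<close> and \<open>Inf\<close> outside that case play no role.
\<close>

definition chi :: "'a::banach set \<Rightarrow> real" where
  "chi A = (INF F \<in> {F. finite F \<and> F \<noteq> {}}. d_hat A F)"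

definition omega :: "('k::real_normed_field \<Rightarrow> 'a::banach \<Rightarrow> 'a) \<Rightarrow> 'a set \<Rightarrow> real" where
  "omega smul A = (INF K \<in> {K. compactin (weak_topology smul) K \<and> K \<noteq> {}}. d_hat A K)"

definition wck :: "('k::real_normed_field \<Rightarrow> 'a::banach \<Rightarrow> 'a) \<Rightarrow> 'a set \<Rightarrow> real" where
  "wck smul A = (SUP x \<in> {x :: nat \<Rightarrow> 'a. range x \<subseteq> A}.
     bidual_setdist smul (weak_star_cluster_points smul x) (range (canonical_embedding smul)))"

definition beta_w :: "('k::real_normed_field \<Rightarrow> 'a::banach \<Rightarrow> 'a) \<Rightarrow> 'a set \<Rightarrow> real" where
  "beta_w smul A = (SUP x \<in> {x :: nat \<Rightarrow> 'a. range x \<subseteq> A}. delta_tilde smul x)"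

definition dominated_by :: "('a::metric_space set \<Rightarrow> real) \<Rightarrow> ('a set \<Rightarrow> real) \<Rightarrow> bool" where
  "dominated_by p q \<longleftrightarrow> (\<exists>C\<ge>0. \<forall>A. A \<noteq> {} \<and> bounded A \<longrightarrow> p A \<le> C * q A)"

definition equivalent_quantities :: "('a::metric_space set \<Rightarrow> real) \<Rightarrow> ('a set \<Rightarrow> real) \<Rightarrow> bool" where
  "equivalent_quantities p q \<longleftrightarrow> dominated_by p q \<and> dominated_by q p"

definition pairwise_equivalent :: "('a::metric_space set \<Rightarrow> real) set \<Rightarrow> bool" where
  "pairwise_equivalent Q \<longleftrightarrow> (\<forall>p \<in> Q. \<forall>q \<in> Q. equivalent_quantities p q)"


section \<open>The quantitative Schur property\<close>

definition c_Schur :: "('k::real_normed_field \<Rightarrow> 'a::banach \<Rightarrow> 'a) \<Rightarrow> real \<Rightarrow> bool" where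
  "c_Schur smul c \<longleftrightarrow> (\<forall>x :: nat \<Rightarrow> 'a. bounded (range x) \<longrightarrow> ca x \<le> c * delta smul x)"

definition quantitative_Schur :: "('k::real_normed_field \<Rightarrow> 'a::banach \<Rightarrow> 'a) \<Rightarrow> bool" where
  "quantitative_Schur smul \<longleftrightarrow> (\<exists>c\<ge>0. c_Schur smul c)"

end

theory Submission
  imports Defs
begin

text \<open>
  For every nonempty bounded set \<open>A\<close>, in any Banach space, \<open>wck A \<le> omega A \<le> chi A\<close>
  (\<open>wck_le_omega\<close>, \<open>omega_le_chi\<close>) and \<open>beta_w A \<le> 14 * wck A\<close> (\<open>beta_w_le_wck\<close>). So the four
  quantities are equivalent as soon as \<open>chi\<close> is dominated by \<open>beta_w\<close>, and this domination is another form
  of the quantitative Schur property.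

  If \<open>X\<close> has the \<open>c\<close>-Schur property and \<open>r < chi A\<close>, then \<open>A\<close> contains an \<open>r\<close>-separated sequence. All
  its subsequences have oscillation at least \<open>r\<close>, so \<open>r \<le> c * beta_w A\<close> (\<open>chi_le_beta_w\<close>).

  Conversely, for the range of a bounded sequence \<open>x\<close> one has \<open>beta_w (range x) \<le> delta x\<close>
  (\<open>beta_w_range_le_delta\<close>) and \<open>ca x \<le> delta x + 4 * chi (range x)\<close> (\<open>ca_le_delta_plus_chi\<close>). If
  \<open>chi \<le> C * beta_w\<close>, these give the Schur property with the constant \<open>1 + 4 * C\<close>.

  The inequality \<open>beta_w \<le> 14 * wck\<close> is a quantitative Eberlein-Smulian theorem: if \<open>wck A < r\<close> then every
  sequence in \<open>A\<close> has a subsequence with \<open>delta\<close> at most \<open>14 * r\<close> (\<open>delta_subseq_le\<close>). It is proved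
  directly, without Rosenthal's theorem on copies of \<open>l1\<close>, from the Hahn-Banach theorem and a diagonal
  argument. The existence of weak-star cluster points and the inequality \<open>wck \<le> omega\<close> both come
  from one compactness argument (\<open>exists_joint_cluster_point\<close>).
\<close>

section \<open>Hahn-Banach theorems for sublinear functionals\<close>

text \<open>Subadditive, positively homogeneous functionals on a real vector space.\<close>

definition sublinear :: "('a::real_vector \<Rightarrow> real) \<Rightarrow> bool" where
  "sublinear p \<longleftrightarrow> (\<forall>x y. p (x + y) \<le> p x + p y) \<and> (\<forall>t\<ge>0. \<forall>x. p (t *\<^sub>R x) = t * p x)"

lemma sublinearI:
  assumes "\<And>x y. p (x + y) \<le> p x + p y" and "\<And>t x. t > 0 \<Longrightarrow> p (t *\<^sub>R x) \<le> t * p x" and "p 0 = 0"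
  shows "sublinear p"
  unfolding sublinear_def
proof (intro conjI allI impI)
  fix t :: real and x assume "t \<ge> 0"
  show "p (t *\<^sub>R x) = t * p x"
  proof (cases "t = 0")
    case False
    with \<open>t \<ge> 0\<close> have t: "t > 0" by simp
    have "p ((1 / t) *\<^sub>R t *\<^sub>R x) \<le> (1 / t) * p (t *\<^sub>R x)"
      using assms(2)[of "1 / t" "t *\<^sub>R x"] t by simp
    then have "t * p x \<le> p (t *\<^sub>R x)" using t by (simp add: field_simps)
    with assms(2)[OF t, of x] show ?thesis by simp
  qed (simp add: assms(3))
qed (rule assms(1))

lemma sublinear_add: "sublinear p \<Longrightarrow> p (x + y) \<le> p x + p y"
  and sublinear_scale: "sublinear p \<Longrightarrow> t \<ge> 0 \<Longrightarrow> p (t *\<^sub>R x) = t * p x"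
  by (auto simp: sublinear_def)

lemma sublinear_zero: "sublinear p \<Longrightarrow> p 0 = 0"
  using sublinear_scale[of p 0 0] by simp

lemma sublinear_ge_minus: "sublinear p \<Longrightarrow> - p (- x) \<le> p x"
  using sublinear_add[of p x "- x"] sublinear_zero[of p] by simp

text \<open>
  The functional \<open>q x = (INF t\<ge>0. p (x + t a) - t p a)\<close> is sublinear, lies below \<open>p\<close> and satisfies
  \<open>q (- a) \<le> - p a\<close>. It is used twice: it shows that minimal sublinear functionals are odd, and
  every linear functional below it agrees with \<open>p\<close> at \<open>a\<close>.
\<close>

lemma sublinear_lower_at:
  fixes p :: "'a::real_vector \<Rightarrow> real"
  assumes p: "sublinear p"
  obtains q where "sublinear q" "q \<le> p" "q (- a) \<le> - p a"
proof
  let ?g = "\<lambda>x t. p (x + t *\<^sub>R a) - t * p a"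
  let ?q = "\<lambda>x. INF t\<in>{0..}. ?g x t"
  have below: "- p (- x) \<le> ?g x t" if "t \<ge> 0" for x t
    using sublinear_add[OF p, of "x + t *\<^sub>R a" "- x"] sublinear_scale[OF p that, of a] by simp
  then have bdd: "bdd_below (?g x ` {0..})" for x by (auto intro!: bdd_belowI)
  have q_le: "?q x \<le> ?g x t" if "t \<ge> 0" for x t
    using bdd that by (intro cINF_lower) auto
  have q_ge: "m \<le> ?q x" if "\<And>t. t \<ge> 0 \<Longrightarrow> m \<le> ?g x t" for m x
    using that by (intro cINF_greatest) auto
  show "?q \<le> p" using q_le[of 0] by (auto simp: le_fun_def)
  show "?q (- a) \<le> - p a" using q_le[of 1 "- a"] sublinear_zero[OF p] by simp
  show "sublinear ?q"
  proof (rule sublinearI)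
    fix x y
    have *: "?q (x + y) \<le> ?g x s + ?g y t" if "s \<ge> 0" "t \<ge> 0" for s t
      using q_le[of "s + t" "x + y"] that sublinear_add[OF p, of "x + s *\<^sub>R a" "y + t *\<^sub>R a"]
      by (simp add: algebra_simps)
    have "?q (x + y) - ?g x s \<le> ?q y" if "s \<ge> 0" for s
      using *[OF that] by (intro q_ge) (simp add: algebra_simps)
    then have "?q (x + y) - ?q y \<le> ?q x"
      by (intro q_ge) (simp add: algebra_simps)
    then show "?q (x + y) \<le> ?q x + ?q y" by simp
  next
    fix t :: real and x assume t: "t > 0"
    have "?q (t *\<^sub>R x) / t \<le> ?q x"
    proof (rule q_ge)
      fix s :: real assume s: "s \<ge> 0"
      have "?q (t *\<^sub>R x) \<le> p (t *\<^sub>R (x + s *\<^sub>R a)) - (t * s) * p a"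
        using q_le[of "t * s" "t *\<^sub>R x"] t s by (simp add: scaleR_add_right)
      also have "\<dots> = t * ?g x s"
        using sublinear_scale[OF p, of t "x + s *\<^sub>R a"] t by (simp add: algebra_simps)
      finally show "?q (t *\<^sub>R x) / t \<le> ?g x s" using t by (simp add: field_simps)
    qed
    then show "?q (t *\<^sub>R x) \<le> t * ?q x" using t by (simp add: field_simps)
  next
    have "?g 0 t = 0" if "t \<ge> 0" for t using sublinear_scale[OF p that] by simp
    then have "?g 0 ` {0..} = {0}" by force
    then show "?q 0 = 0" by simp
  qed
qed

lemma sublinear_Inf_chain:
  fixes C :: "('a::real_vector \<Rightarrow> real) set"
  assumes C: "C \<noteq> {}" "\<And>q. q \<in> C \<Longrightarrow> sublinear q \<and> q \<le> p"
    and chain: "\<And>q r. q \<in> C \<Longrightarrow> r \<in> C \<Longrightarrow> q \<le> r \<or> r \<le> q"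
  shows "sublinear (\<lambda>x. INF q\<in>C. q x)" and "\<And>q. q \<in> C \<Longrightarrow> (\<lambda>x. INF q\<in>C. q x) \<le> q"
proof -
  let ?u = "\<lambda>x. INF q\<in>C. q x"
  have "- p (- x) \<le> q x" if "q \<in> C" for q x
    using sublinear_ge_minus[of q x] le_funD[of q p "- x"] C(2)[OF that] by simp
  then have bdd: "bdd_below ((\<lambda>q. q x) ` C)" for x by (auto intro!: bdd_belowI)
  have u_le: "?u x \<le> q x" if "q \<in> C" for q x
    using bdd that by (intro cINF_lower) auto
  have u_ge: "m \<le> ?u x" if "\<And>q. q \<in> C \<Longrightarrow> m \<le> q x" for m x
    using that C by (intro cINF_greatest) auto
  show "?u \<le> q" if "q \<in> C" for q using u_le[OF that] by (simp add: le_fun_def)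
  show "sublinear ?u"
  proof (rule sublinearI)
    fix x y
    have *: "?u (x + y) \<le> q x + r y" if q: "q \<in> C" and r: "r \<in> C" for q r
    proof -
      obtain m where m: "m \<in> C" "m \<le> q" "m \<le> r" using chain[OF q r] q r by auto
      have "?u (x + y) \<le> m x + m y"
        using u_le[OF m(1), of "x + y"] sublinear_add[of m x y] C(2)[OF m(1)] by simp
      with m(2,3) show ?thesis unfolding le_fun_def by (meson add_mono order_trans)
    qed
    have "?u (x + y) - q x \<le> ?u y" if "q \<in> C" for q
      using *[OF that] by (intro u_ge) (simp add: algebra_simps)
    then have "?u (x + y) - ?u y \<le> ?u x"
      by (intro u_ge) (simp add: algebra_simps)
    then show "?u (x + y) \<le> ?u x + ?u y" by simp
  next
    fix t :: real and x assume t: "t > 0"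
    have "?u (t *\<^sub>R x) / t \<le> ?u x"
    proof (rule u_ge)
      fix q assume q: "q \<in> C"
      have "?u (t *\<^sub>R x) \<le> t * q x"
        using u_le[OF q, of "t *\<^sub>R x"] sublinear_scale[of q t x] C(2)[OF q] t by simp
      then show "?u (t *\<^sub>R x) / t \<le> q x" using t by (simp add: field_simps)
    qed
    then show "?u (t *\<^sub>R x) \<le> t * ?u x" using t by (simp add: field_simps)
  next
    have "(\<lambda>q. q 0) ` C = {0}" using C sublinear_zero by force
    then show "?u 0 = 0" by simp
  qed
qed

text \<open>
  Zorn's lemma gives a minimal element among the sublinear functionals below \<open>p\<close>. Minimality makes
  it odd, and an odd sublinear functional is linear. No extension of functionals from subspaces
  is needed.
\<close>

lemma exists_linear_below_sublinear:
  fixes p :: "'a::real_vector \<Rightarrow> real"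
  assumes p: "sublinear p"
  obtains u where "linear u" "u \<le> p"
proof -
  let ?S = "{q. sublinear q \<and> q \<le> p}"
  let ?R = "\<lambda>q r :: 'a \<Rightarrow> real. r \<le> q"
  have "\<exists>m\<in>?S. \<forall>a\<in>?S. ?R m a \<longrightarrow> a = m"
  proof (rule predicate_Zorn)
    show "partial_order_on ?S (relation_of ?R ?S)"
      by (rule partial_order_on_relation_ofI) auto
  next
    fix C assume C: "C \<in> Chains (relation_of ?R ?S)"
    show "\<exists>u\<in>?S. \<forall>a\<in>C. ?R a u"
    proof (cases "C = {}")
      case True
      then show ?thesis using p by auto
    next
      case False
      have 1: "sublinear q \<and> q \<le> p" if "q \<in> C" for q
        using C that by (auto simp: Chains_def relation_of_def)
      have 2: "q \<le> r \<or> r \<le> q" if "q \<in> C" "r \<in> C" for q r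
        using C that by (auto simp: Chains_def relation_of_def)
      note inf = sublinear_Inf_chain[OF False 1 2]
      obtain q where "q \<in> C" using False by blast
      with inf(2)[of q] 1[of q] have "(\<lambda>x. INF q\<in>C. q x) \<le> p" by (meson order_trans)
      with inf show ?thesis by blast
    qed
  qed
  then obtain u where u: "sublinear u" "u \<le> p"
    and min: "\<And>q. sublinear q \<Longrightarrow> q \<le> u \<Longrightarrow> q = u"
    by (smt (verit) mem_Collect_eq order_trans)
  have minus: "u (- a) = - u a" for a
  proof (rule antisym)
    obtain q where "sublinear q" "q \<le> u" "q (- a) \<le> - u a"
      using sublinear_lower_at[OF u(1)] by metis
    with min show "u (- a) \<le> - u a" by metis
    show "- u a \<le> u (- a)" using sublinear_ge_minus[OF u(1), of "- a"] by simp
  qed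
  have add: "u (x + y) = u x + u y" for x y
    using sublinear_add[OF u(1), of x y] sublinear_add[OF u(1), of "- x" "- y"] minus[of "x + y"]
      minus[of x] minus[of y] by simp
  have scale: "u (t *\<^sub>R x) = t * u x" for t x
  proof (cases "t \<ge> 0")
    case False
    then show ?thesis
      using sublinear_scale[OF u(1), of "- t" x] minus[of "t *\<^sub>R x"] by simp
  qed (simp add: sublinear_scale[OF u(1)])
  have "linear u" by (rule linearI) (simp_all add: add scale)
  then show ?thesis using u(2) that by blast
qed

lemma Hahn_Banach_support:
  fixes p :: "'a::real_vector \<Rightarrow> real"
  assumes p: "sublinear p"
  obtains u where "linear u" "\<And>x. u x \<le> p x" "u a = p a"
proof -
  obtain q where q: "sublinear q" "q \<le> p" "q (- a) \<le> - p a"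
    using sublinear_lower_at[OF p] by metis
  obtain u where u: "linear u" "u \<le> q" using exists_linear_below_sublinear[OF q(1)] .
  have le: "u x \<le> p x" for x using u(2) q(2) by (auto simp: le_fun_def intro: order_trans)
  have "u (- a) \<le> - p a" using u(2) q(3) by (auto simp: le_fun_def intro: order_trans)
  then have "p a \<le> u a" by (simp add: linear_neg[OF u(1)])
  with le[of a] have "u a = p a" by simp
  with u(1) le show ?thesis using that by blast
qed

lemma infdist_lessE:
  assumes "A \<noteq> {}" "infdist x A < r"
  obtains a where "a \<in> A" "dist x a < r"
proof -
  have "bdd_below (dist x ` A)" by (rule bdd_belowI[of _ 0]) auto
  then have "\<exists>a\<in>A. dist x a < r"
    using assms by (simp add: infdist_def cINF_less_iff)
  then show ?thesis using that by blast
qed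

text \<open>
  The distance to a subspace is sublinear; a linear functional below it vanishes on the subspace.
\<close>

lemma Hahn_Banach_subspace:
  fixes Y :: "'a::real_normed_vector set"
  assumes Y: "subspace Y"
  shows "\<exists>u. linear u \<and> (\<forall>x. \<bar>u x\<bar> \<le> norm x) \<and> (\<forall>y\<in>Y. u y = 0) \<and> u a = infdist a Y"
proof -
  have ne: "Y \<noteq> {}" using subspace_0[OF Y] by auto
  have eps: "c \<le> d" if "\<And>e. e > 0 \<Longrightarrow> c \<le> d + e" for c d :: real
    using that by (rule field_le_epsilon)
  have "sublinear (\<lambda>x. infdist x Y)"
  proof (rule sublinearI)
    fix x y
    show "infdist (x + y) Y \<le> infdist x Y + infdist y Y"
    proof (rule eps)
      fix e :: real assume e: "e > 0"
      obtain a b where a: "a \<in> Y" "dist x a < infdist x Y + e/2"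
        and b: "b \<in> Y" "dist y b < infdist y Y + e/2"
        using infdist_lessE[OF ne, of x "infdist x Y + e/2"]
          infdist_lessE[OF ne, of y "infdist y Y + e/2"] e by (metis less_add_same_cancel1 half_gt_zero)
      have "infdist (x + y) Y \<le> dist (x + y) (a + b)"
        by (rule infdist_le) (rule subspace_add[OF Y a(1) b(1)])
      also have "\<dots> \<le> dist x a + dist y b" by (rule dist_triangle_add)
      finally show "infdist (x + y) Y \<le> infdist x Y + infdist y Y + e" using a(2) b(2) by simp
    qed
  next
    fix t :: real and x assume t: "t > 0"
    show "infdist (t *\<^sub>R x) Y \<le> t * infdist x Y"
    proof (rule eps)
      fix e :: real assume e: "e > 0"
      obtain a where a: "a \<in> Y" "dist x a < infdist x Y + e/t"
        using infdist_lessE[OF ne, of x "infdist x Y + e/t"] e t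
        by (metis divide_pos_pos less_add_same_cancel1)
      have "infdist (t *\<^sub>R x) Y \<le> dist (t *\<^sub>R x) (t *\<^sub>R a)"
        by (rule infdist_le) (rule subspace_scale[OF Y a(1)])
      also have "\<dots> = t * dist x a"
        using t by (simp add: dist_norm flip: scaleR_diff_right)
      also have "\<dots> \<le> t * (infdist x Y + e/t)" using a(2) t by (intro mult_left_mono) auto
      also have "\<dots> = t * infdist x Y + e" using t by (simp add: field_simps)
      finally show "infdist (t *\<^sub>R x) Y \<le> t * infdist x Y + e" .
    qed
  next
    show "infdist 0 Y = 0" using subspace_0[OF Y] by simp
  qed
  then obtain u where u: "linear u" "\<And>x. u x \<le> infdist x Y" "u a = infdist a Y"
    using Hahn_Banach_support by metis
  have le: "u x \<le> norm x" for x
    using u(2)[of x] infdist_le[OF subspace_0[OF Y], of x] by (simp add: dist_norm)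
  have "\<bar>u x\<bar> \<le> norm x" for x
    using le[of x] le[of "- x"] by (simp add: linear_neg[OF u(1)])
  moreover have "u y = 0" if "y \<in> Y" for y
    using u(2)[of y] u(2)[of "- y"] that subspace_neg[OF Y that] by (simp add: linear_neg[OF u(1)])
  ultimately show ?thesis using u(1,3) by (intro exI[of _ u]) simp
qed

lemma Hahn_Banach_norming:
  fixes a :: "'a::real_normed_vector"
  shows "\<exists>u. linear u \<and> (\<forall>x. \<bar>u x\<bar> \<le> norm x) \<and> u a = norm a"
proof -
  have "subspace {0::'a}" by simp
  from Hahn_Banach_subspace[OF this, of a] show ?thesis by auto
qed

text \<open>
  The span of a sequence is separable: lists of pairs (rational coefficient, index) form a
  countable set, and the vectors that they encode approximate every element of the span.
\<close>

lemma span_range_dense_sequence: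
  fixes w :: "nat \<Rightarrow> 'a::real_normed_vector"
  shows "\<exists>d :: nat \<Rightarrow> 'a. \<forall>y\<in>span (range w). \<forall>e>0. \<exists>j. norm (y - d j) < e"
proof (rule exI, intro ballI allI impI)
  let ?D = "\<lambda>l :: (rat \<times> nat) list. foldr (\<lambda>(q, n) v. of_rat q *\<^sub>R w n + v) l 0"
  fix y :: 'a and e :: real
  assume "y \<in> span (range w)" "e > 0"
  then have "\<exists>l. norm (y - ?D l) < e"
  proof (induction arbitrary: e rule: span_induct_alt)
    case base
    have "norm (0 - ?D []) < e" using base by simp
    then show ?case ..
  next
    case (step c v y)
    then obtain n where n: "v = w n" by auto
    obtain l where l: "norm (y - ?D l) < e/2" using step.IH[of "e/2"] step.prems by auto
    have "e / (2 * (norm v + 1)) > 0" using step.prems by (simp add: add_nonneg_pos)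
    then obtain q where q: "c < of_rat q" "of_rat q < c + e / (2 * (norm v + 1))"
      using of_rat_dense[of c "c + e / (2 * (norm v + 1))"] by auto
    have "norm ((c - of_rat q) *\<^sub>R v) \<le> e / (2 * (norm v + 1)) * (norm v + 1)"
      unfolding norm_scaleR using q by (intro mult_mono) auto
    also have "\<dots> = e/2" by (simp add: divide_simps) (smt (verit) norm_ge_zero)
    finally have "norm ((c - of_rat q) *\<^sub>R v + (y - ?D l)) < e"
      using l norm_triangle_ineq[of "(c - of_rat q) *\<^sub>R v" "y - ?D l"] by simp
    then have "norm (c *\<^sub>R v + y - ?D ((q, n) # l)) < e"
      by (simp add: n algebra_simps)
    then show ?case by blast
  qed
  then obtain l where "norm (y - ?D l) < e" ..
  then have "norm (y - ?D (from_nat (to_nat l))) < e" by simp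
  then show "\<exists>j. norm (y - ?D (from_nat j)) < e" by blast
qed


section \<open>The Cauchy oscillation of a bounded sequence\<close>

lemma ca_le:
  fixes x :: "nat \<Rightarrow> 'b::metric_space"
  assumes "bounded (range x)" "\<And>i j. i \<ge> N \<Longrightarrow> j \<ge> N \<Longrightarrow> dist (x i) (x j) \<le> s"
  shows "ca x \<le> s"
proof -
  have "bounded (x ` {n..})" for n using assms(1) by (rule bounded_subset) auto
  then have "bdd_below (range (\<lambda>n. diameter (x ` {n..})))"
    by (intro bdd_belowI[of _ 0]) (auto intro: diameter_ge_0)
  then have "ca x \<le> diameter (x ` {N..})"
    unfolding ca_def by (intro cINF_lower) auto
  also have "\<dots> \<le> s"
    unfolding diameter_def using assms(2) by (auto intro!: cSUP_least)
  finally show ?thesis .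
qed

lemma ca_ge:
  fixes x :: "nat \<Rightarrow> 'b::metric_space"
  assumes "bounded (range x)" "\<And>n. \<exists>i\<ge>n. \<exists>j\<ge>n. s \<le> dist (x i) (x j)"
  shows "s \<le> ca x"
  unfolding ca_def
proof (rule cINF_greatest)
  fix n
  obtain i j where ij: "i \<ge> n" "j \<ge> n" "s \<le> dist (x i) (x j)" using assms(2) by blast
  have "bounded (x ` {n..})" using assms(1) by (rule bounded_subset) auto
  from diameter_bounded_bound[OF this, of "x i" "x j"] ij
  show "s \<le> diameter (x ` {n..})" by force
qed simp

lemma ca_nonneg: "bounded (range x) \<Longrightarrow> 0 \<le> ca x"
  by (rule ca_ge) auto

lemma ca_reindex_le:
  fixes x :: "nat \<Rightarrow> 'b::metric_space"
  assumes x: "bounded (range x)" and m: "filterlim m at_top sequentially"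
  shows "ca (x \<circ> m) \<le> ca x"
proof -
  have "ca (x \<circ> m) \<le> diameter (x ` {n..})" for n
  proof -
    obtain N where N: "\<And>i. i \<ge> N \<Longrightarrow> m i \<ge> n"
      using m unfolding filterlim_at_top eventually_sequentially by blast
    show ?thesis
    proof (rule ca_le)
      show "bounded (range (x \<circ> m))" using x by (rule bounded_subset) auto
      show "dist ((x \<circ> m) i) ((x \<circ> m) j) \<le> diameter (x ` {n..})" if "i \<ge> N" "j \<ge> N" for i j
        using N that by (intro diameter_bounded_bound bounded_subset[OF x]) auto
    qed
  qed
  then show ?thesis unfolding ca_def[of x] by (intro cINF_greatest) auto
qed

lemma frequently_subseq:
  fixes P :: "nat \<Rightarrow> bool"
  assumes "\<exists>\<^sub>F n in sequentially. P n"
  shows "\<exists>r :: nat \<Rightarrow> nat. strict_mono r \<and> (\<forall>n. P (r n))"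
proof -
  have "infinite {n. P n}"
    using assms by (simp add: frequently_cofinite flip: cofinite_eq_sequentially)
  from infinite_enumerate[OF this] show ?thesis by auto
qed


section \<open>The dual ball and the quantities delta and beta\<close>

context normed_scaling
begin

lemma dual_ballD:
  assumes "f \<in> dual_ball smul"
  shows "f \<in> dual_space smul" "bounded_linear f" "norm (f x) \<le> norm x"
    "f (x - y) = f x - f y"
proof -
  show 1: "f \<in> dual_space smul" and 2: "bounded_linear f"
    using assms by (auto simp: dual_ball_def dual_space_def)
  have "norm (f x) \<le> onorm f * norm x" using 2 by (rule onorm)
  also have "\<dots> \<le> 1 * norm x" using assms by (intro mult_right_mono) (auto simp: dual_ball_def)
  finally show "norm (f x) \<le> norm x" by simp
  interpret bounded_linear f by fact
  show "f (x - y) = f x - f y" by (rule diff)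
qed

lemma dual_ballI:
  assumes "linear f" "\<And>c x. f (smul c x) = c * f x" "\<And>x. norm (f x) \<le> norm x"
  shows "f \<in> dual_ball smul"
proof -
  interpret linear f by fact
  have "bounded_linear f" using assms(3) by unfold_locales (auto intro!: exI[of _ 1])
  then show ?thesis
    using assms by (auto simp: dual_ball_def dual_space_def intro!: onorm_bound)
qed

lemma zero_in_dual_ball: "(\<lambda>_. 0) \<in> dual_ball smul"
  by (rule dual_ballI) (auto simp: linear_zero)

lemma dual_ball_nonempty: "dual_ball smul \<noteq> {}"
  using zero_in_dual_ball by blast

lemma bounded_dual_image:
  assumes "f \<in> dual_ball smul" "bounded (range x)"
  shows "bounded (range (\<lambda>n::nat. f (x n)))"
  using bounded_linear_image[OF assms(2) dual_ballD(2)[OF assms(1)]] by (simp add: image_image)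

lemma bdd_above_delta:
  assumes x: "bounded (range x)"
  shows "bdd_above ((\<lambda>f. ca (\<lambda>n. f (x n))) ` dual_ball smul)"
proof (rule bdd_aboveI2)
  fix f assume f: "f \<in> dual_ball smul"
  show "ca (\<lambda>n. f (x n)) \<le> diameter (range x)"
  proof (rule ca_le[OF bounded_dual_image[OF f x]])
    fix i j
    have "dist (f (x i)) (f (x j)) \<le> dist (x i) (x j)"
      using dual_ballD[OF f] by (metis dist_norm)
    also have "\<dots> \<le> diameter (range x)" using x by (intro diameter_bounded_bound) auto
    finally show "dist (f (x i)) (f (x j)) \<le> diameter (range x)" .
  qed
qed

lemma ca_le_delta:
  assumes "bounded (range x)" "f \<in> dual_ball smul"
  shows "ca (\<lambda>n. f (x n)) \<le> delta smul x"
  unfolding delta_def using assms by (intro cSUP_upper bdd_above_delta)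

lemma delta_le:
  assumes "\<And>f. f \<in> dual_ball smul \<Longrightarrow> ca (\<lambda>n. f (x n)) \<le> s"
  shows "delta smul x \<le> s"
  unfolding delta_def using assms dual_ball_nonempty by (intro cSUP_least)

lemma delta_nonneg:
  assumes "bounded (range x)"
  shows "0 \<le> delta smul x"
  using ca_nonneg[OF bounded_dual_image[OF zero_in_dual_ball assms]]
    ca_le_delta[OF assms zero_in_dual_ball] by linarith

lemma delta_reindex_le:
  assumes x: "bounded (range x)" and m: "filterlim m at_top sequentially"
  shows "delta smul (x \<circ> m) \<le> delta smul x"
proof (rule delta_le)
  fix f assume f: "f \<in> dual_ball smul"
  have "ca (\<lambda>n. f ((x \<circ> m) n)) \<le> ca (\<lambda>n. f (x n))"
    using ca_reindex_le[OF bounded_dual_image[OF f x] m] by (simp add: o_def)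
  also have "\<dots> \<le> delta smul x" using ca_le_delta[OF x f] .
  finally show "ca (\<lambda>n. f ((x \<circ> m) n)) \<le> delta smul x" .
qed

lemma delta_tilde_le:
  assumes x: "bounded (range x)" and r: "strict_mono r"
  shows "delta_tilde smul x \<le> delta smul (x \<circ> r)"
proof -
  have "bounded (range (x \<circ> s))" for s :: "nat \<Rightarrow> nat" using x by (rule bounded_subset) auto
  then show ?thesis
    unfolding delta_tilde_def using r
    by (intro cINF_lower) (auto intro!: bdd_belowI[of _ 0] delta_nonneg)
qed

lemma delta_tilde_ge:
  assumes "\<And>r. strict_mono r \<Longrightarrow> s \<le> delta smul (x \<circ> r)"
  shows "s \<le> delta_tilde smul x"
  unfolding delta_tilde_def using assms strict_mono_id
  by (intro cINF_greatest) auto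

lemma beta_w_le:
  assumes "A \<noteq> {}" "\<And>x. range x \<subseteq> A \<Longrightarrow> delta_tilde smul x \<le> s"
  shows "beta_w smul A \<le> s"
proof -
  obtain a where "a \<in> A" using assms(1) by blast
  then have "(\<lambda>_::nat. a) \<in> {x. range x \<subseteq> A}" by auto
  then have "{x :: nat \<Rightarrow> 'a. range x \<subseteq> A} \<noteq> {}" by blast
  then show ?thesis
    unfolding beta_w_def using assms(2) by (intro cSUP_least) auto
qed

lemma delta_tilde_le_beta_w:
  assumes A: "bounded A" and x: "range x \<subseteq> A"
  shows "delta_tilde smul x \<le> beta_w smul A"
  unfolding beta_w_def
proof (rule cSUP_upper)
  show "bdd_above (delta_tilde smul ` {x. range x \<subseteq> A})"
  proof (rule bdd_aboveI2)
    fix y :: "nat \<Rightarrow> 'a" assume "y \<in> {x. range x \<subseteq> A}"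
    then have y: "range y \<subseteq> A" by simp
    have by': "bounded (range y)" using A y by (rule bounded_subset)
    have "delta_tilde smul y \<le> delta smul y"
      using delta_tilde_le[OF by' strict_mono_id] by (simp add: o_def id_def)
    also have "\<dots> \<le> diameter A"
    proof (rule delta_le)
      fix f assume f: "f \<in> dual_ball smul"
      show "ca (\<lambda>n. f (y n)) \<le> diameter A"
      proof (rule ca_le[OF bounded_dual_image[OF f by']])
        fix i j
        have "dist (f (y i)) (f (y j)) \<le> dist (y i) (y j)"
          using dual_ballD[OF f] by (metis dist_norm)
        also have "\<dots> \<le> diameter A" using A y by (intro diameter_bounded_bound) auto
        finally show "dist (f (y i)) (f (y j)) \<le> diameter A" .
      qed
    qed
    finally show "delta_tilde smul y \<le> diameter A" .
  qed
qed (use x in simp)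

text \<open>
  A sequence in the range of \<open>x\<close> is \<open>x \<circ> m\<close> for some \<open>m\<close>. Either \<open>m\<close> takes one value infinitely often,
  and there is a constant subsequence, or \<open>m\<close> tends to infinity.
\<close>

lemma beta_w_range_le_delta:
  assumes x: "bounded (range x)"
  shows "beta_w smul (range x) \<le> delta smul x"
proof (rule beta_w_le)
  fix y :: "nat \<Rightarrow> 'a" assume y: "range y \<subseteq> range x"
  then have "\<forall>n. \<exists>k. y n = x k" by auto
  then obtain m where m: "\<And>n. y n = x (m n)" by metis
  then have ym: "y = x \<circ> m" by auto
  have by': "bounded (range y)" using x y by (rule bounded_subset)
  show "delta_tilde smul y \<le> delta smul x"
  proof (cases "\<exists>v. \<exists>\<^sub>F n in sequentially. m n = v")
    case True
    then obtain v where v: "\<exists>\<^sub>F n in sequentially. m n = v" ..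
    obtain r :: "nat \<Rightarrow> nat" where r: "strict_mono r" "\<And>n. m (r n) = v"
      using frequently_subseq[OF v] by auto
    have "delta_tilde smul y \<le> delta smul (y \<circ> r)" using delta_tilde_le[OF by' r(1)] .
    also have "\<dots> \<le> 0"
      by (intro delta_le ca_le[of _ 0]) (auto simp: ym r(2))
    finally show ?thesis using delta_nonneg[OF x] by simp
  next
    case False
    then have ev: "\<forall>\<^sub>F n in sequentially. m n \<noteq> v" for v by (auto simp: frequently_def)
    have "\<forall>\<^sub>F n in sequentially. k \<le> m n" for k
    proof -
      have "\<forall>\<^sub>F n in sequentially. \<forall>v\<in>{..<k}. m n \<noteq> v"
        using ev by (intro eventually_ball_finite) auto
      then show ?thesis by (rule eventually_mono) (metis lessThan_iff linorder_not_le)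
    qed
    then have "filterlim m at_top sequentially" by (simp add: filterlim_at_top)
    then have "delta smul y \<le> delta smul x" using delta_reindex_le[OF x] ym by simp
    moreover have "delta_tilde smul y \<le> delta smul y"
      using delta_tilde_le[OF by' strict_mono_id] by (simp add: o_def id_def)
    ultimately show ?thesis by simp
  qed
qed simp

end

section \<open>The Hausdorff measure of noncompactness\<close>

lemma bdd_above_infdist:
  assumes "bounded A" "B \<noteq> {}"
  shows "bdd_above ((\<lambda>a. infdist a B) ` A)"
proof -
  obtain b where b: "b \<in> B" using assms by blast
  obtain M where "\<And>a. a \<in> A \<Longrightarrow> dist b a \<le> M" using assms(1) by (meson bounded_any_center)
  then show ?thesis using b by (intro bdd_aboveI2[of _ _ M]) (metis infdist_le2 dist_commute)
qed

lemma infdist_le_d_hat: "bounded A \<Longrightarrow> B \<noteq> {} \<Longrightarrow> a \<in> A \<Longrightarrow> infdist a B \<le> d_hat A B"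
  unfolding d_hat_def by (intro cSUP_upper bdd_above_infdist)

lemma d_hat_nonneg:
  assumes "bounded A" "A \<noteq> {}" "B \<noteq> {}"
  shows "0 \<le> d_hat A B"
proof -
  obtain a where "a \<in> A" using assms by blast
  then show ?thesis using infdist_le_d_hat[OF assms(1,3)] infdist_nonneg[of a B] by (meson order_trans)
qed

lemma chi_le_d_hat:
  assumes "bounded A" "A \<noteq> {}" "finite F" "F \<noteq> {}"
  shows "chi A \<le> d_hat A F"
  unfolding chi_def using assms
  by (intro cINF_lower) (auto intro!: bdd_belowI[of _ 0] d_hat_nonneg)

lemma finite_cover_of_chi_less:
  fixes A :: "'a::banach set"
  assumes "bounded A" "A \<noteq> {}" "chi A < r"
  shows "\<exists>F. finite F \<and> F \<noteq> {} \<and> (\<forall>a\<in>A. \<exists>p\<in>F. dist a p < r)"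
proof -
  let ?Fs = "{F :: 'a set. finite F \<and> F \<noteq> {}}"
  have "{0} \<in> ?Fs" by simp
  then have "?Fs \<noteq> {}" by blast
  moreover have "bdd_below (d_hat A ` ?Fs)"
    using assms by (auto intro!: bdd_belowI[of _ 0] d_hat_nonneg)
  ultimately have "\<exists>F\<in>?Fs. d_hat A F < r"
    using assms(3) cINF_less_iff[of ?Fs "d_hat A" r] unfolding chi_def by blast
  then obtain F where F: "finite F" "F \<noteq> {}" "d_hat A F < r" by blast
  show ?thesis
  proof (intro exI[of _ F] conjI F(1,2) ballI)
    fix a assume "a \<in> A"
    then have "infdist a F < r" using infdist_le_d_hat[OF assms(1) F(2)] F(3) by fastforce
    then show "\<exists>p\<in>F. dist a p < r" using infdist_lessE[OF F(2)] by metis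
  qed
qed

text \<open>
  Points are chosen one by one: no finite set \<open>F\<close> of earlier points satisfies \<open>d_hat A F \<le> r\<close>.
\<close>

lemma separated_sequence:
  fixes A :: "'a::banach set"
  assumes A: "bounded A" "A \<noteq> {}" and r: "r < chi A"
  obtains x :: "nat \<Rightarrow> 'a" where "range x \<subseteq> A" "\<And>i j. i \<noteq> j \<Longrightarrow> r < dist (x i) (x j)"
proof -
  have step: "\<exists>a\<in>A. \<forall>p\<in>F. r < dist a p" if "finite F" for F
  proof (cases "F = {}")
    case False
    have "r < (SUP a\<in>A. infdist a F)"
      using chi_le_d_hat[OF A that False] r by (simp add: d_hat_def)
    then obtain a where "a \<in> A" "r < infdist a F"
      using less_cSUP_iff[OF A(2) bdd_above_infdist[OF A(1) False]] by blast
    then show ?thesis by (meson infdist_le less_le_trans)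
  qed (use A in auto)
  define next_pt where "next_pt = (\<lambda>F. SOME a. a \<in> A \<and> (\<forall>p\<in>F. r < dist a p))"
  have next_pt: "next_pt F \<in> A \<and> (\<forall>p\<in>F. r < dist (next_pt F) p)" if "finite F" for F
    unfolding next_pt_def by (rule someI_ex) (use step[OF that] in blast)
  define G where "G = rec_nat {} (\<lambda>_ F. insert (next_pt F) F)"
  have G: "G 0 = {}" "G (Suc n) = insert (next_pt (G n)) (G n)" for n by (simp_all add: G_def)
  have fin: "finite (G n)" for n by (induction n) (simp_all add: G)
  have mono: "G i \<subseteq> G j" if "i \<le> j" for i j
    using that by (induction rule: dec_induct) (auto simp: G)
  have lt: "r < dist (next_pt (G j)) (next_pt (G i))" if "i < j" for i j
  proof -
    have "next_pt (G i) \<in> G j" using mono[of "Suc i" j] that by (auto simp: G)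
    then show ?thesis using next_pt[OF fin] by blast
  qed
  show ?thesis
  proof (rule that[of "\<lambda>n. next_pt (G n)"])
    show "range (\<lambda>n. next_pt (G n)) \<subseteq> A" using next_pt fin by auto
    show "r < dist (next_pt (G i)) (next_pt (G j))" if "i \<noteq> j" for i j
      using lt[of i j] lt[of j i] that by (cases i j rule: linorder_cases) (auto simp: dist_commute)
  qed
qed

context normed_scaling
begin

text \<open>
  All subsequences of an \<open>r\<close>-separated sequence have oscillation at least \<open>r\<close>, hence, by the Schur
  inequality, \<open>delta\<close> at least \<open>r / c\<close>.
\<close>

lemma chi_le_beta_w:
  assumes c: "c_Schur smul c" "c > 0" and A: "bounded A" "A \<noteq> {}"
  shows "chi A \<le> c * beta_w smul A"
proof (rule dense_le)
  fix r assume "r < chi A"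
  then obtain x :: "nat \<Rightarrow> 'a" where x: "range x \<subseteq> A" "\<And>i j. i \<noteq> j \<Longrightarrow> r < dist (x i) (x j)"
    using separated_sequence[OF A] by metis
  have "r / c \<le> delta_tilde smul x"
  proof (rule delta_tilde_ge)
    fix s :: "nat \<Rightarrow> nat" assume s: "strict_mono s"
    have b: "bounded (range (x \<circ> s))" by (rule bounded_subset[OF A(1)]) (use x(1) in auto)
    have "r \<le> ca (x \<circ> s)"
    proof (rule ca_ge[OF b])
      fix n
      have "s n \<noteq> s (Suc n)" using s by (simp add: strict_mono_eq)
      then show "\<exists>i\<ge>n. \<exists>j\<ge>n. r \<le> dist ((x \<circ> s) i) ((x \<circ> s) j)"
        using x(2)[of "s n" "s (Suc n)"] by (intro exI[of _ n] conjI exI[of _ "Suc n"]) auto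
    qed
    also have "\<dots> \<le> c * delta smul (x \<circ> s)" using c(1) b by (simp add: c_Schur_def)
    finally show "r / c \<le> delta smul (x \<circ> s)" using c(2) by (simp add: field_simps)
  qed
  also have "\<dots> \<le> beta_w smul A" using delta_tilde_le_beta_w[OF A(1) x(1)] .
  finally show "r \<le> c * beta_w smul A" using c(2) by (simp add: field_simps)
qed

end


section \<open>Weak-star cluster points\<close>

text \<open>
  The scalar fields enter the remaining arguments through two properties only: closed balls are
  compact, and every real-linear functional of norm at most one is dominated by the modulus of an
  element of the dual ball. The latter holds with \<open>g = u\<close> over the reals, and with the functional whose
  real part is \<open>u\<close> over the complex numbers.
\<close>

locale norming_scaling = normed_scaling smul
  for smul :: "'k::{real_normed_field, heine_borel} \<Rightarrow> 'a::banach \<Rightarrow> 'a" +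
  assumes real_functional_dominated:
    "linear u \<Longrightarrow> (\<And>x. \<bar>u x\<bar> \<le> norm x) \<Longrightarrow> \<exists>g\<in>dual_ball smul. \<forall>x. \<bar>u x :: real\<bar> \<le> norm (g x)"
begin

lemma canonical_embedding_in_bidual: "canonical_embedding smul x \<in> bidual smul"
proof -
  have "(\<lambda>y. f y + g y) \<in> dual_space smul" if "f \<in> dual_space smul" "g \<in> dual_space smul" for f g
    using that by (auto simp: dual_space_def bounded_linear_add algebra_simps)
  moreover have "(\<lambda>y. c * f y) \<in> dual_space smul" if "f \<in> dual_space smul" for f c
    using that by (auto simp: dual_space_def bounded_linear_const_mult algebra_simps)
  moreover have "norm (f x) \<le> norm x * onorm f" if "f \<in> dual_space smul" for f
    using that onorm[of f x] by (simp add: dual_space_def mult.commute)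
  ultimately show ?thesis
    by (auto simp: bidual_def canonical_embedding_def intro!: exI[of _ "norm x"])
qed

lemma bidual_ball_bounded:
  assumes "\<phi> \<in> bidual smul" "\<psi> \<in> bidual smul"
  shows "bdd_above ((\<lambda>f. norm (\<phi> f - \<psi> f)) ` dual_ball smul)"
proof -
  have "\<exists>C. \<forall>f\<in>dual_space smul. norm (\<phi> f) \<le> C * onorm f"
    and "\<exists>C. \<forall>f\<in>dual_space smul. norm (\<psi> f) \<le> C * onorm f"
    using assms by (simp_all add: bidual_def)
  then obtain C D where C: "\<And>f. f \<in> dual_space smul \<Longrightarrow> norm (\<phi> f) \<le> C * onorm f"
    and D: "\<And>f. f \<in> dual_space smul \<Longrightarrow> norm (\<psi> f) \<le> D * onorm f" by metis
  show ?thesis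
  proof (rule bdd_aboveI2)
    fix f assume f: "f \<in> dual_ball smul"
    have o: "0 \<le> onorm f" "onorm f \<le> 1"
      using f onorm_pos_le[OF dual_ballD(2)[OF f]] by (auto simp: dual_ball_def)
    have "a * onorm f \<le> \<bar>a\<bar>" for a
      using mult_right_mono[OF abs_ge_self[of a] o(1)] mult_left_mono[OF o(2), of "\<bar>a\<bar>"] by simp
    from this[of C] this[of D] show "norm (\<phi> f - \<psi> f) \<le> \<bar>C\<bar> + \<bar>D\<bar>"
      using C[OF dual_ballD(1)[OF f]] D[OF dual_ballD(1)[OF f]] norm_triangle_ineq4[of "\<phi> f" "\<psi> f"]
      by linarith
  qed
qed

lemma norm_le_bidual_dist:
  assumes "\<phi> \<in> bidual smul" "\<psi> \<in> bidual smul" "f \<in> dual_ball smul"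
  shows "norm (\<phi> f - \<psi> f) \<le> bidual_dist smul \<phi> \<psi>"
  unfolding bidual_dist_def using assms by (intro cSUP_upper bidual_ball_bounded)

lemma bidual_dist_nonneg:
  assumes "\<phi> \<in> bidual smul" "\<psi> \<in> bidual smul"
  shows "0 \<le> bidual_dist smul \<phi> \<psi>"
  by (rule order_trans[OF norm_ge_zero norm_le_bidual_dist[OF assms zero_in_dual_ball]])

end

lemma compactin_sequence_cluster:
  assumes C: "compactin X C" and s: "\<And>n::nat. s n \<in> C"
  shows "\<exists>c\<in>C. \<forall>U. openin X U \<and> c \<in> U \<longrightarrow> (\<exists>\<^sub>F n in sequentially. s n \<in> U)"
proof (rule ccontr)
  assume "\<not> ?thesis"
  then have "\<forall>c\<in>C. \<exists>U. openin X U \<and> c \<in> U \<and> (\<forall>\<^sub>F n in sequentially. s n \<notin> U)"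
    by (auto simp: not_frequently)
  then obtain U where U: "\<And>c. c \<in> C \<Longrightarrow> openin X (U c)" "\<And>c. c \<in> C \<Longrightarrow> c \<in> U c"
    "\<And>c. c \<in> C \<Longrightarrow> \<forall>\<^sub>F n in sequentially. s n \<notin> U c" by metis
  have cover: "\<exists>\<F>. finite \<F> \<and> \<F> \<subseteq> \<U> \<and> C \<subseteq> \<Union>\<F>"
    if "\<And>V. V \<in> \<U> \<Longrightarrow> openin X V" "C \<subseteq> \<Union>\<U>" for \<U>
    using C that by (simp add: compactin_def)
  have "\<exists>\<F>. finite \<F> \<and> \<F> \<subseteq> U ` C \<and> C \<subseteq> \<Union>\<F>"
    by (rule cover) (use U(1,2) in auto)
  then obtain \<F> where F: "finite \<F>" "\<F> \<subseteq> U ` C" "C \<subseteq> \<Union>\<F>" by blast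
  have "\<forall>\<^sub>F n in sequentially. \<forall>V\<in>\<F>. s n \<notin> V"
    using F U(3) by (intro eventually_ball_finite) auto
  then obtain n where "\<forall>V\<in>\<F>. s n \<notin> V" unfolding eventually_sequentially by blast
  with F(3) s[of n] show False by blast
qed

lemma openin_product_finite_balls:
  fixes \<phi> :: "'i \<Rightarrow> 'b::real_normed_vector"
  assumes F: "finite F" "F \<subseteq> I"
  shows "openin (product_topology (\<lambda>_. euclidean) I)
    {\<psi> \<in> extensional I. \<forall>i\<in>F. norm (\<psi> i - \<phi> i) < e}"
proof -
  let ?S = "\<lambda>i. if i \<in> F then ball (\<phi> i) e else UNIV"
  have "{i \<in> I. ?S i \<noteq> topspace (euclidean :: 'b topology)} \<subseteq> F" by auto
  then have "finite {i \<in> I. ?S i \<noteq> topspace (euclidean :: 'b topology)}"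
    using F(1) by (rule finite_subset)
  then have "openin (product_topology (\<lambda>_. euclidean) I) (PiE I ?S)"
    by (intro openin_PiE_gen[THEN iffD2] disjI2 conjI) simp_all
  moreover have "PiE I ?S = {\<psi> \<in> extensional I. \<forall>i\<in>F. norm (\<psi> i - \<phi> i) < e}"
  proof (rule set_eqI)
    fix \<psi>
    have "(\<forall>i\<in>I. \<psi> i \<in> ?S i) \<longleftrightarrow> (\<forall>i\<in>F. \<psi> i \<in> ball (\<phi> i) e)"
      using F(2) by (metis UNIV_I subsetD)
    then show "\<psi> \<in> PiE I ?S \<longleftrightarrow> \<psi> \<in> {\<psi> \<in> extensional I. \<forall>i\<in>F. norm (\<psi> i - \<phi> i) < e}"
      unfolding PiE_iff by (simp add: dist_norm norm_minus_commute conj_commute)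
  qed
  ultimately show ?thesis by simp
qed

context norming_scaling
begin

lemma cluster_point_frequently:
  assumes \<phi>: "\<phi> \<in> weak_star_cluster_points smul x" and F: "finite F" "F \<subseteq> dual_space smul" and e: "e > 0"
  shows "\<exists>\<^sub>F n in sequentially. \<forall>f\<in>F. norm (f (x n) - \<phi> f) < e"
proof -
  let ?T = "{\<psi> \<in> extensional (dual_space smul). \<forall>f\<in>F. norm (\<psi> f - \<phi> f) < e}"
  have "openin (weak_star_topology smul) (?T \<inter> bidual smul)"
    unfolding weak_star_topology_def openin_subtopology
    using openin_product_finite_balls[OF F, of \<phi> e] by blast
  moreover have "\<phi> \<in> ?T \<inter> bidual smul"
    using \<phi> e by (auto simp: weak_star_cluster_points_def bidual_def)
  ultimately have "\<exists>\<^sub>F n in sequentially. canonical_embedding smul (x n) \<in> ?T \<inter> bidual smul"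
    using \<phi> unfolding weak_star_cluster_points_def by blast
  then show ?thesis
    by (rule frequently_mono[rotated]) (use F(2) in \<open>auto simp: canonical_embedding_def\<close>)
qed

text \<open>
  A Banach-Alaoglu argument for two sequences at once. The product of a weak-star compact box
  containing the image of \<open>x\<close> and the weakly compact set \<open>K\<close> is compact, so the sequence of pairs
  clusters there. The joint cluster point is what allows \<open>\<phi>\<close> and \<open>z\<close> to be compared along the
  same indices.
\<close>

lemma exists_joint_cluster_point:
  assumes x: "bounded (range x)" and K: "compactin (weak_topology smul) K" and y: "\<And>n::nat. y n \<in> K"
  shows "\<exists>\<phi>\<in>weak_star_cluster_points smul x. \<exists>z\<in>K. \<forall>f\<in>dual_space smul. \<forall>e>0.
      \<exists>\<^sub>F n in sequentially. norm (f (x n) - \<phi> f) < e \<and> norm (f (y n) - f z) < e"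
proof -
  let ?D = "dual_space smul" and ?J = "canonical_embedding smul"
  let ?P = "product_topology (\<lambda>_. euclidean) ?D :: (('a \<Rightarrow> 'k) \<Rightarrow> 'k) topology"
  obtain M where M: "\<And>n. norm (x n) \<le> M" using x by (auto simp: bounded_iff)
  let ?B = "PiE ?D (\<lambda>f. cball 0 (M * onorm f))"
  have B: "compactin ?P ?B" by (simp add: compactin_PiE)
  have bl: "bounded_linear f" if "f \<in> ?D" for f using that by (simp add: dual_space_def)
  have onf: "norm (f (x n)) \<le> M * onorm f" if "f \<in> ?D" for f n
  proof -
    have "norm (f (x n)) \<le> onorm f * norm (x n)" using onorm[OF bl[OF that]] .
    also have "\<dots> \<le> onorm f * M" using M onorm_pos_le[OF bl[OF that]] by (intro mult_left_mono)
    finally show ?thesis by (simp add: mult.commute)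
  qed
  have BK: "compactin (prod_topology ?P (weak_topology smul)) (?B \<times> K)"
    using B K by (simp add: compactin_Times)
  have xy: "(?J (x n), y n) \<in> ?B \<times> K" for n
    using onf y by (auto simp: canonical_embedding_def)
  obtain c where c: "c \<in> ?B \<times> K" and clus:
    "\<And>U. openin (prod_topology ?P (weak_topology smul)) U \<Longrightarrow> c \<in> U \<Longrightarrow>
      \<exists>\<^sub>F n in sequentially. (?J (x n), y n) \<in> U"
    using compactin_sequence_cluster[where s = "\<lambda>n. (?J (x n), y n)", OF BK xy] by blast
  obtain \<phi> z where cz: "c = (\<phi>, z)" by (cases c)
  have \<phi>B: "\<phi> \<in> ?B" and zK: "z \<in> K" using c cz by auto
  have \<phi>ext: "\<phi> \<in> extensional ?D" using \<phi>B by (simp add: PiE_def)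
  have topJ: "?J v \<in> topspace ?P" for v by (simp add: canonical_embedding_def)
  \<comment> \<open>\<open>\<phi>\<close> is so far only a function in the box; that it is a bounded linear functional on the dual
    follows from approximating it by evaluations at \<open>x n\<close>.\<close>
  have joint: "\<exists>\<^sub>F n in sequentially. ?J (x n) \<in> T \<and> ?J (y n) \<in> S"
    if "openin ?P T" "\<phi> \<in> T" "openin ?P S" "?J z \<in> S" for T S
  proof -
    have "openin (weak_topology smul) (?J -` S)"
      unfolding weak_topology_def openin_pullback_topology using that(3) by blast
    then have "openin (prod_topology ?P (weak_topology smul)) (T \<times> (?J -` S))"
      using that(1) by (simp add: openin_prod_Times_iff)
    from clus[OF this] that(2,4) cz show ?thesis by simp
  qed
  have near: "\<exists>\<^sub>F n in sequentially. (\<forall>f\<in>F. norm (f (x n) - \<phi> f) < e) \<and> (\<forall>f\<in>F. norm (f (y n) - f z) < e)"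
    if F: "finite F" "F \<subseteq> ?D" and e: "e > 0" for F e
  proof -
    have "\<exists>\<^sub>F n in sequentially. ?J (x n) \<in> {\<psi> \<in> extensional ?D. \<forall>f\<in>F. norm (\<psi> f - \<phi> f) < e}
        \<and> ?J (y n) \<in> {\<psi> \<in> extensional ?D. \<forall>f\<in>F. norm (\<psi> f - ?J z f) < e}"
      using \<phi>ext e F(2)
      by (intro joint openin_product_finite_balls F) (auto simp: canonical_embedding_def)
    then show ?thesis
      by (rule frequently_mono[rotated]) (use F(2) in \<open>auto simp: canonical_embedding_def\<close>)
  qed
  have add_D: "(\<lambda>v. f v + g v) \<in> ?D" if "f \<in> ?D" "g \<in> ?D" for f g
    using that by (auto simp: dual_space_def bounded_linear_add algebra_simps)
  have mult_D: "(\<lambda>v. a * f v) \<in> ?D" if "f \<in> ?D" for f a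
    using that by (auto simp: dual_space_def bounded_linear_const_mult algebra_simps)
  have zeroI: "a = b" if le: "\<And>e. e > 0 \<Longrightarrow> norm (a - b) \<le> C * e" for a b :: 'k and C :: real
  proof -
    have "norm (a - b) \<le> 0 + e" if "e > 0" for e
    proof -
      have "norm (a - b) \<le> C * (e / (\<bar>C\<bar> + 1))" using \<open>e > 0\<close> by (intro le) (simp add: add_nonneg_pos)
      also have "\<dots> \<le> (\<bar>C\<bar> + 1) * (e / (\<bar>C\<bar> + 1))" using \<open>e > 0\<close> by (intro mult_right_mono) auto
      also have "\<dots> = e" using abs_ge_zero[of C] by simp
      finally show ?thesis by simp
    qed
    then have "norm (a - b) \<le> 0" by (rule field_le_epsilon)
    then show ?thesis by simp
  qed
  have "\<phi> (\<lambda>v. f v + g v) = \<phi> f + \<phi> g" if f: "f \<in> ?D" and g: "g \<in> ?D" for f g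
  proof (rule zeroI[of _ _ 3])
    fix e :: real assume e: "e > 0"
    have "{f, g, \<lambda>v. f v + g v} \<subseteq> ?D" using f g add_D[OF f g] by simp
    from frequently_ex[OF near[OF _ this e]]
    obtain n where n: "norm (f (x n) - \<phi> f) < e" "norm (g (x n) - \<phi> g) < e"
      "norm ((f (x n) + g (x n)) - \<phi> (\<lambda>v. f v + g v)) < e"
      by auto
    have "\<phi> (\<lambda>v. f v + g v) - (\<phi> f + \<phi> g)
        = (f (x n) - \<phi> f) + (g (x n) - \<phi> g) - ((f (x n) + g (x n)) - \<phi> (\<lambda>v. f v + g v))" by simp
    also have "norm \<dots> \<le> norm (f (x n) - \<phi> f) + norm (g (x n) - \<phi> g)
        + norm ((f (x n) + g (x n)) - \<phi> (\<lambda>v. f v + g v))"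
      by (rule order_trans[OF norm_triangle_ineq4 add_right_mono[OF norm_triangle_ineq]])
    finally show "norm (\<phi> (\<lambda>v. f v + g v) - (\<phi> f + \<phi> g)) \<le> 3 * e" using n by simp
  qed
  moreover have "\<phi> (\<lambda>v. a * f v) = a * \<phi> f" if f: "f \<in> ?D" for f a
  proof (rule zeroI[of _ _ "1 + norm a"])
    fix e :: real assume e: "e > 0"
    have "{f, \<lambda>v. a * f v} \<subseteq> ?D" using f mult_D[OF f] by simp
    from frequently_ex[OF near[OF _ this e]]
    obtain n where n: "norm (f (x n) - \<phi> f) < e" "norm (a * f (x n) - \<phi> (\<lambda>v. a * f v)) < e"
      by auto
    have "\<phi> (\<lambda>v. a * f v) - a * \<phi> f = a * (f (x n) - \<phi> f) - (a * f (x n) - \<phi> (\<lambda>v. a * f v))"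
      by (simp add: algebra_simps)
    also have "norm \<dots> \<le> norm a * norm (f (x n) - \<phi> f) + norm (a * f (x n) - \<phi> (\<lambda>v. a * f v))"
      using norm_triangle_ineq4[of "a * (f (x n) - \<phi> f)"] by (simp only: norm_mult)
    also have "\<dots> \<le> norm a * e + e" using n by (intro add_mono mult_left_mono) auto
    finally show "norm (\<phi> (\<lambda>v. a * f v) - a * \<phi> f) \<le> (1 + norm a) * e" by (simp add: algebra_simps)
  qed
  moreover have "norm (\<phi> f) \<le> M * onorm f" if "f \<in> ?D" for f
    using \<phi>B that by (auto simp: PiE_def Pi_def)
  ultimately have \<phi>: "\<phi> \<in> bidual smul"
    using \<phi>ext unfolding bidual_def by (intro CollectI conjI ballI allI exI[of _ M])
  have "\<phi> \<in> weak_star_cluster_points smul x"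
    unfolding weak_star_cluster_points_def
  proof (intro CollectI conjI allI impI \<phi>)
    fix U assume U: "openin (weak_star_topology smul) U \<and> \<phi> \<in> U"
    then obtain T where T: "openin ?P T" "U = T \<inter> bidual smul"
      unfolding weak_star_topology_def openin_subtopology by blast
    have "\<exists>\<^sub>F n in sequentially. ?J (x n) \<in> T \<and> ?J (y n) \<in> topspace ?P"
      using T U topJ by (intro joint openin_topspace) auto
    then show "\<exists>\<^sub>F n in sequentially. ?J (x n) \<in> U"
      by (rule frequently_mono[rotated]) (use T canonical_embedding_in_bidual in auto)
  qed
  then show ?thesis
  proof (rule bexI[rotated], intro bexI[OF _ zK] ballI allI impI)
    fix f and e :: real assume "f \<in> ?D" "e > 0"
    then show "\<exists>\<^sub>F n in sequentially. norm (f (x n) - \<phi> f) < e \<and> norm (f (y n) - f z) < e"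
      using near[of "{f}" e] by simp
  qed
qed

section \<open>Comparison of wck, omega and chi\<close>

text \<open>
  The weak-star cluster points of a sequence, and their distance to the canonical image of the space.
\<close>

abbreviation "clust x \<equiv> weak_star_cluster_points smul x"
abbreviation "dist_to_X x \<equiv> bidual_setdist smul (clust x) (range (canonical_embedding smul))"

lemma clust_subset_bidual: "clust x \<subseteq> bidual smul"
  by (auto simp: weak_star_cluster_points_def)

lemma bdd_below_dist_to_X:
  "bdd_below ((\<lambda>(\<phi>, \<psi>). bidual_dist smul \<phi> \<psi>) ` (clust x \<times> range (canonical_embedding smul)))"
  by (rule bdd_belowI2[of _ 0])
    (auto intro!: bidual_dist_nonneg subsetD[OF clust_subset_bidual] canonical_embedding_in_bidual)

lemma weakly_compact_finite: "finite K \<Longrightarrow> compactin (weak_topology smul) K"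
  by (rule finite_imp_compactin)
    (auto simp: weak_topology_def topspace_pullback_topology canonical_embedding_def)

lemma clust_nonempty:
  assumes "bounded (range x)"
  shows "clust x \<noteq> {}"
proof -
  have K: "compactin (weak_topology smul) {0}" by (rule weakly_compact_finite) simp
  then show ?thesis
    using exists_joint_cluster_point[where y = "\<lambda>_. 0", OF assms K] by auto
qed

text \<open>
  If \<open>y\<close> is a sequence in \<open>K\<close> with \<open>norm (x n - y n) < r\<close> for all \<open>n\<close>, then a joint cluster point
  \<open>(\<phi>, z)\<close> satisfies \<open>norm (\<phi> - z) \<le> r\<close>.
\<close>

lemma dist_to_X_le_d_hat:
  assumes A: "bounded A" and x: "range x \<subseteq> A" and K: "compactin (weak_topology smul) K" "K \<noteq> {}"
  shows "dist_to_X x \<le> d_hat A K"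
proof (rule dense_ge)
  fix r assume r: "d_hat A K < r"
  have "\<exists>y\<in>K. dist (x n) y < r" for n
  proof -
    have "infdist (x n) K \<le> d_hat A K" using x by (intro infdist_le_d_hat A K) auto
    then have "infdist (x n) K < r" using r by simp
    then show ?thesis by (rule infdist_lessE[OF K(2)]) blast
  qed
  then obtain y where y: "\<And>n. y n \<in> K" "\<And>n. dist (x n) (y n) < r" by metis
  have bx: "bounded (range x)" using A x by (rule bounded_subset)
  obtain \<phi> z where \<phi>: "\<phi> \<in> clust x" and z: "z \<in> K"
    and near: "\<And>f e. f \<in> dual_space smul \<Longrightarrow> e > 0 \<Longrightarrow>
      \<exists>\<^sub>F n in sequentially. norm (f (x n) - \<phi> f) < e \<and> norm (f (y n) - f z) < e"
    using exists_joint_cluster_point[where y = y, OF bx K(1) y(1)] by auto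
  have "dist_to_X x \<le> bidual_dist smul \<phi> (canonical_embedding smul z)"
    unfolding bidual_setdist_def using \<phi> by (intro cINF_lower2[OF bdd_below_dist_to_X]) auto
  also have "\<dots> \<le> r"
    unfolding bidual_dist_def
  proof (rule cSUP_least[OF dual_ball_nonempty])
    fix f assume f: "f \<in> dual_ball smul"
    have "norm (\<phi> f - f z) \<le> r"
    proof (rule field_le_epsilon)
      fix e :: real assume "e > 0"
      then obtain n where n: "norm (f (x n) - \<phi> f) < e/2" "norm (f (y n) - f z) < e/2"
        using frequently_ex[OF near[OF dual_ballD(1)[OF f], of "e/2"]] by auto
      have "norm (f (x n) - f (y n)) \<le> r"
        using dual_ballD(3)[OF f, of "x n - y n"] dual_ballD(4)[OF f, of "x n" "y n"] y(2)[of n]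
        by (simp add: dist_norm)
      moreover have "norm (\<phi> f - f z) \<le> norm (\<phi> f - f (x n)) + norm (f (x n) - f (y n)) + norm (f (y n) - f z)"
        using norm_triangle_ineq[of "\<phi> f - f (x n)" "f (x n) - f (y n)"]
          norm_triangle_ineq[of "\<phi> f - f (y n)" "f (y n) - f z"] by simp
      ultimately show "norm (\<phi> f - f z) \<le> r + e"
        using n by (simp add: norm_minus_commute)
    qed
    then show "norm (\<phi> f - canonical_embedding smul z f) \<le> r"
      using dual_ballD(1)[OF f] by (simp add: canonical_embedding_def)
  qed
  finally show "dist_to_X x \<le> r" .
qed

lemma wck_le_omega:
  assumes A: "bounded A" "A \<noteq> {}"
  shows "wck smul A \<le> omega smul A"
  unfolding wck_def
proof (rule cSUP_least)
  obtain a where "a \<in> A" using A by blast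
  then have "(\<lambda>_::nat. a) \<in> {x. range x \<subseteq> A}" by auto
  then show "{x :: nat \<Rightarrow> 'a. range x \<subseteq> A} \<noteq> {}" by blast
next
  fix x :: "nat \<Rightarrow> 'a" assume "x \<in> {x. range x \<subseteq> A}"
  then have x: "range x \<subseteq> A" by simp
  have "{0} \<in> {K. compactin (weak_topology smul) K \<and> K \<noteq> {}}"
    using weakly_compact_finite[of "{0}"] by blast
  then have "{K. compactin (weak_topology smul) K \<and> K \<noteq> {}} \<noteq> {}" by blast
  then show "dist_to_X x \<le> omega smul A"
    unfolding omega_def by (intro cINF_greatest dist_to_X_le_d_hat A x) auto
qed

lemma omega_le_chi:
  assumes A: "bounded A" "A \<noteq> {}"
  shows "omega smul A \<le> chi A"
  unfolding omega_def chi_def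
proof (rule cINF_superset_mono)
  show "{F :: 'a set. finite F \<and> F \<noteq> {}} \<noteq> {}" by (auto intro: exI[of _ "{0}"])
  show "bdd_below (d_hat A ` {K. compactin (weak_topology smul) K \<and> K \<noteq> {}})"
    using A by (auto intro!: bdd_belowI[of _ 0] d_hat_nonneg)
qed (auto simp: weakly_compact_finite)

lemma dist_to_X_le_wck:
  assumes A: "bounded A" and x: "range x \<subseteq> A"
  shows "dist_to_X x \<le> wck smul A"
  unfolding wck_def
proof (rule cSUP_upper)
  show "bdd_above (dist_to_X ` {x. range x \<subseteq> A})"
    by (rule bdd_aboveI2[of _ _ "d_hat A {0}"])
      (auto intro!: dist_to_X_le_d_hat A weakly_compact_finite)
qed (use x in simp)

text \<open>
  This is the only consequence of \<open>wck smul A < r\<close> used below; it no longer mentions the bidual.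
\<close>

lemma frequently_near_point_of_wck_less:
  assumes A: "bounded A" and x: "range x \<subseteq> A" and r: "wck smul A < r"
  shows "\<exists>z. \<forall>F. finite F \<longrightarrow> F \<subseteq> dual_ball smul \<longrightarrow>
    (\<exists>\<^sub>F n in sequentially. \<forall>f\<in>F. norm (f (x n) - f z) < r)"
proof -
  have bx: "bounded (range x)" using A x by (rule bounded_subset)
  let ?S = "clust x \<times> range (canonical_embedding smul)"
  have ne: "?S \<noteq> {}" using clust_nonempty[OF bx] by auto
  have "(INF (\<phi>, \<psi>)\<in>?S. bidual_dist smul \<phi> \<psi>) < r"
    using dist_to_X_le_wck[OF A x] r by (simp add: bidual_setdist_def)
  then have "\<exists>p\<in>?S. (case p of (\<phi>, \<psi>) \<Rightarrow> bidual_dist smul \<phi> \<psi>) < r"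
    using cINF_less_iff[OF ne bdd_below_dist_to_X] by blast
  then obtain \<phi> z where \<phi>: "\<phi> \<in> clust x" and d: "bidual_dist smul \<phi> (canonical_embedding smul z) < r"
    by auto
  show ?thesis
  proof (intro exI[of _ z] allI impI)
    fix F assume F: "finite F" "F \<subseteq> dual_ball smul"
    then have "F \<subseteq> dual_space smul" using dual_ballD(1) by blast
    then have "\<exists>\<^sub>F n in sequentially. \<forall>f\<in>F.
        norm (f (x n) - \<phi> f) < r - bidual_dist smul \<phi> (canonical_embedding smul z)"
      using cluster_point_frequently[OF \<phi> F(1)] d by simp
    then show "\<exists>\<^sub>F n in sequentially. \<forall>f\<in>F. norm (f (x n) - f z) < r"
    proof (rule frequently_mono[rotated], intro allI impI ballI)
      fix n f assume *: "\<forall>f\<in>F. norm (f (x n) - \<phi> f) < r - bidual_dist smul \<phi> (canonical_embedding smul z)"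
        and f: "f \<in> F"
      have "norm (\<phi> f - f z) \<le> bidual_dist smul \<phi> (canonical_embedding smul z)"
        using norm_le_bidual_dist[of \<phi> "canonical_embedding smul z" f] \<phi> clust_subset_bidual
          canonical_embedding_in_bidual F f dual_ballD(1)[of f]
        by (auto simp: canonical_embedding_def)
      with * f norm_triangle_ineq[of "f (x n) - \<phi> f" "\<phi> f - f z"]
      show "norm (f (x n) - f z) < r" by fastforce
    qed
  qed
qed

end


section \<open>A quantitative Eberlein-Smulian theorem\<close>

context norming_scaling
begin

text \<open>
  The quantitative form of Whitley's proof of the Eberlein-Smulian theorem. Let \<open>z\<close> be as above for
  \<open>x\<close>. A diagonal choice gives a subsequence along which countably many functionals, norming the real
  span \<open>Y\<close> of the vectors \<open>x n - z\<close>, are eventually smaller than \<open>r\<close> on \<open>x n - z\<close>. If another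
  functional \<open>f\<close> were at least \<open>7 r\<close> on \<open>x n - z\<close> for infinitely many \<open>n\<close> of this subsequence, let
  \<open>y\<close> be the point belonging to these \<open>n\<close>. Then \<open>y - z\<close> is at distance less than \<open>2 r\<close> from \<open>Y\<close>, by
  Hahn-Banach, and the norming functionals are at most \<open>2 r\<close> on it; so \<open>norm (y - z) < 6 r\<close>. Since
  \<open>f\<close> is smaller than \<open>r\<close> on \<open>x n - y\<close> for some of these \<open>n\<close>, it is smaller than \<open>7 r\<close> on \<open>x n - z\<close>,
  a contradiction. So all functionals in the dual ball are eventually smaller than \<open>7 r\<close> on \<open>x n - z\<close>,
  and oscillate by at most \<open>14 r\<close>.
\<close>

lemma delta_subseq_le:
  fixes x :: "nat \<Rightarrow> 'a"
  assumes A: "bounded A" and x: "range x \<subseteq> A" and r: "wck smul A < r" "0 < r"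
  obtains s where "strict_mono s" "delta smul (x \<circ> s) \<le> 14 * r"
proof -
  have bx: "bounded (range x)" using A x by (rule bounded_subset)
  obtain z where "\<forall>F. finite F \<longrightarrow> F \<subseteq> dual_ball smul \<longrightarrow>
      (\<exists>\<^sub>F n in sequentially. \<forall>f\<in>F. norm (f (x n) - f z) < r)"
    using frequently_near_point_of_wck_less[OF A x r(1)] ..
  note z = this[rule_format]
  \<comment> \<open>The span over the reals, not over \<open>'k\<close>: functionals on it are handled through their real
    versions.\<close>
  define Y where "Y = Real_Vector_Spaces.span (range (\<lambda>n. x n - z))"
  obtain d :: "nat \<Rightarrow> 'a" where "\<forall>y\<in>Y. \<forall>e>0. \<exists>j. norm (y - d j) < e"
    unfolding Y_def using span_range_dense_sequence ..
  note d = this[rule_format]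
  have "\<exists>p. linear (fst p) \<and> (\<forall>v. \<bar>fst p v\<bar> \<le> norm v) \<and> fst p (d j) = norm (d j) \<and>
      snd p \<in> dual_ball smul \<and> (\<forall>v. \<bar>fst p v :: real\<bar> \<le> norm (snd p v))" for j
  proof -
    obtain u where u: "linear u \<and> (\<forall>x. \<bar>u x\<bar> \<le> norm x) \<and> u (d j) = norm (d j)"
      using Hahn_Banach_norming ..
    obtain g where "g \<in> dual_ball smul" "\<forall>v. \<bar>u v\<bar> \<le> norm (g v)"
      using real_functional_dominated[of u] u by auto
    with u show ?thesis by (intro exI[of _ "(u, g)"]) simp
  qed
  then obtain p where p: "\<forall>j. linear (fst (p j)) \<and> (\<forall>v. \<bar>fst (p j) v\<bar> \<le> norm v) \<and>
      fst (p j) (d j) = norm (d j) \<and> snd (p j) \<in> dual_ball smul \<and>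
      (\<forall>v. \<bar>fst (p j) v :: real\<bar> \<le> norm (snd (p j) v))"
    using choice[of "\<lambda>j p. linear (fst p) \<and> (\<forall>v. \<bar>fst p v\<bar> \<le> norm v) \<and> fst p (d j) = norm (d j) \<and>
      snd p \<in> dual_ball smul \<and> (\<forall>v. \<bar>fst p v :: real\<bar> \<le> norm (snd p v))"] by auto
  define u where "u = (\<lambda>j. fst (p j))"
  define g where "g = (\<lambda>j. snd (p j))"
  have u: "linear (u j)" "\<bar>u j v\<bar> \<le> norm v" "u j (d j) = norm (d j)"
    and g: "g j \<in> dual_ball smul" "\<bar>u j v\<bar> \<le> norm (g j v)" for j v
    using p by (simp_all add: u_def g_def)
  \<comment> \<open>The \<open>u j\<close> norm \<open>Y\<close>, being norming at the points of a sequence that approximates \<open>Y\<close>.\<close>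
  have norming: "norm y \<le> b" if y: "y \<in> Y" and b: "\<And>j. \<bar>u j y\<bar> \<le> b" for y b
  proof (rule field_le_epsilon)
    fix e :: real assume "e > 0"
    then obtain j where j: "norm (y - d j) < e/2" using d[OF y, of "e/2"] by auto
    have "norm (d j) = u j y - u j (y - d j)" by (simp add: u(3) linear_diff[OF u(1)])
    also have "\<dots> \<le> b + norm (y - d j)" using b[of j] u(2)[of j "y - d j"] by linarith
    finally show "norm y \<le> b + e"
      using j norm_triangle_ineq[of "y - d j" "d j"] by simp
  qed
  have "\<exists>s. \<forall>k. (\<forall>j\<le>k. norm (g j (x (s k)) - g j z) < r) \<and> s k < s (Suc k)"
  proof (rule dependent_nat_choice)
    have fr: "\<exists>n\<ge>m. \<forall>j\<le>k. norm (g j (x n) - g j z) < r" for k m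
    proof -
      have "\<exists>\<^sub>F n in sequentially. \<forall>f\<in>g ` {..k}. norm (f (x n) - f z) < r"
        using g(1) by (intro z) auto
      then have "\<exists>n\<ge>m. \<forall>f\<in>g ` {..k}. norm (f (x n) - f z) < r"
        unfolding frequently_sequentially ..
      then show ?thesis by auto
    qed
    show "\<exists>n. \<forall>j\<le>0. norm (g j (x n) - g j z) < r" using fr[of 0 0] by blast
    show "\<exists>n'. (\<forall>j\<le>Suc k. norm (g j (x n') - g j z) < r) \<and> n < n'" for n k
      using fr[of "Suc n" "Suc k"] by (metis Suc_le_lessD)
  qed
  then obtain s where "\<forall>k. (\<forall>j\<le>k. norm (g j (x (s k)) - g j z) < r) \<and> s k < s (Suc k)" ..
  then have s: "j \<le> k \<Longrightarrow> norm (g j (x (s k)) - g j z) < r" and smono: "strict_mono s" for j k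
    by (simp_all add: strict_mono_Suc_iff)
  have small: "\<forall>\<^sub>F k in sequentially. norm (f (x (s k)) - f z) < 7 * r"
    if f: "f \<in> dual_ball smul" for f
  proof (rule ccontr)
    assume "\<not> ?thesis"
    then have "\<exists>\<^sub>F k in sequentially. 7 * r \<le> norm (f (x (s k)) - f z)"
      by (simp add: not_eventually not_less)
    then obtain t :: "nat \<Rightarrow> nat" where t: "strict_mono t" "\<And>k. 7 * r \<le> norm (f (x (s (t k))) - f z)"
      using frequently_subseq[of "\<lambda>k. 7 * r \<le> norm (f (x (s k)) - f z)"] by auto
    have "range (\<lambda>k. x (s (t k))) \<subseteq> A" using x by auto
    from frequently_near_point_of_wck_less[OF A this r(1)]
    obtain y where "\<forall>F. finite F \<longrightarrow> F \<subseteq> dual_ball smul \<longrightarrow>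
      (\<exists>\<^sub>F k in sequentially. \<forall>h\<in>F. norm (h (x (s (t k))) - h y) < r)" ..
    note y = this[rule_format]
    have y1: "\<exists>k\<ge>m. norm (h (x (s (t k))) - h y) < r" if "h \<in> dual_ball smul" for h m
      using y[of "{h}"] that by (auto simp: frequently_sequentially)
    have uyz: "\<bar>u j (y - z)\<bar> \<le> 2 * r" for j
    proof -
      obtain k where k: "k \<ge> j" "norm (g j (x (s (t k))) - g j y) < r" using y1[OF g(1)] by blast
      have "j \<le> t k" using k(1) strict_mono_imp_increasing[OF t(1), of k] by simp
      from s[OF this] k(2)
        norm_triangle_ineq4[of "g j (x (s (t k))) - g j z" "g j (x (s (t k))) - g j y"]
      have "norm (g j y - g j z) \<le> 2 * r" by simp
      then show ?thesis using g(2)[of j "y - z"] dual_ballD(4)[OF g(1)[of j], of y z] by simp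
    qed
    have "infdist (y - z) Y < 2 * r"
    proof -
      obtain v where v': "linear v \<and> (\<forall>w. \<bar>v w\<bar> \<le> norm w) \<and> (\<forall>w\<in>Y. v w = 0) \<and>
          v (y - z) = infdist (y - z) Y"
        using Hahn_Banach_subspace[OF real_vector.subspace_span, of _ "y - z"] unfolding Y_def ..
      then have v: "linear v" "\<bar>v w\<bar> \<le> norm w" "w \<in> Y \<Longrightarrow> v w = 0"
        "v (y - z) = infdist (y - z) Y" for w by simp_all
      obtain h where h: "h \<in> dual_ball smul" "\<And>w. \<bar>v w\<bar> \<le> norm (h w)"
        using real_functional_dominated[OF v(1,2)] by blast
      obtain k where k: "norm (h (x (s (t k))) - h y) < r" using y1[OF h(1)] by blast
      have "x (s (t k)) - z \<in> Y" unfolding Y_def by (intro real_vector.span_base) auto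
      from v(3)[OF this] have "v (x (s (t k)) - y) = - v (y - z)"
        by (simp add: linear_diff[OF v(1)])
      then have "\<bar>v (y - z)\<bar> \<le> norm (h (x (s (t k)) - y))" using h(2)[of "x (s (t k)) - y"] by simp
      also have "\<dots> < r" using k dual_ballD(4)[OF h(1), of "x (s (t k))" y] by simp
      finally show ?thesis using v(4) r(2) by simp
    qed
    moreover have "Y \<noteq> {}" unfolding Y_def using real_vector.span_zero by auto
    ultimately obtain w where w: "w \<in> Y" "norm (y - z - w) < 2 * r"
      using infdist_lessE[of Y "y - z" "2 * r"] unfolding dist_norm by blast
    have "norm w \<le> 4 * r"
    proof (rule norming[OF w(1)])
      show "\<bar>u j w\<bar> \<le> 4 * r" for j
        using uyz[of j] u(2)[of j "y - z - w"] w(2) by (simp add: linear_diff[OF u(1)])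
    qed
    then have yz: "norm (y - z) < 6 * r" using w(2) norm_triangle_ineq[of "y - z - w" w] by simp
    obtain k where k: "norm (f (x (s (t k))) - f y) < r" using y1[OF f] by blast
    have "norm (f (x (s (t k))) - f z) \<le> norm (f (x (s (t k))) - f y) + norm (f y - f z)"
      using norm_triangle_ineq[of "f (x (s (t k))) - f y" "f y - f z"] by simp
    also have "norm (f y - f z) \<le> norm (y - z)"
      using dual_ballD(3)[OF f, of "y - z"] dual_ballD(4)[OF f, of y z] by simp
    finally show False using t(2)[of k] k yz by simp
  qed
  have "delta smul (x \<circ> s) \<le> 14 * r"
  proof (rule delta_le)
    fix f assume f: "f \<in> dual_ball smul"
    obtain N where N: "\<And>k. k \<ge> N \<Longrightarrow> norm (f (x (s k)) - f z) < 7 * r"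
      using small[OF f] unfolding eventually_sequentially by blast
    have "bounded (range (x \<circ> s))" using bx by (rule bounded_subset) auto
    note bounded_dual_image[OF f this]
    then show "ca (\<lambda>n. f ((x \<circ> s) n)) \<le> 14 * r"
    proof (rule ca_le)
      fix i j assume "i \<ge> N" "j \<ge> N"
      then show "dist (f ((x \<circ> s) i)) (f ((x \<circ> s) j)) \<le> 14 * r"
        using N[of i] N[of j] norm_triangle_ineq4[of "f (x (s i)) - f z" "f (x (s j)) - f z"]
        by (simp add: dist_norm)
    qed
  qed
  with smono show ?thesis by (rule that)
qed

lemma wck_nonneg:
  assumes A: "bounded A" "A \<noteq> {}"
  shows "0 \<le> wck smul A"
proof -
  obtain a where "a \<in> A" using A by blast
  then have a: "range (\<lambda>_::nat. a) \<subseteq> A" by auto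
  have "clust (\<lambda>_. a) \<noteq> {}" by (rule clust_nonempty) simp
  then have "0 \<le> dist_to_X (\<lambda>_. a)"
    unfolding bidual_setdist_def using clust_subset_bidual canonical_embedding_in_bidual
    by (intro cINF_greatest) (auto intro!: bidual_dist_nonneg)
  also have "\<dots> \<le> wck smul A" using dist_to_X_le_wck[OF A(1) a] .
  finally show ?thesis .
qed

lemma beta_w_le_wck:
  assumes A: "bounded A" "A \<noteq> {}"
  shows "beta_w smul A \<le> 14 * wck smul A"
proof (rule beta_w_le[OF A(2)])
  fix x :: "nat \<Rightarrow> 'a" assume x: "range x \<subseteq> A"
  have bx: "bounded (range x)" using A(1) x by (rule bounded_subset)
  have "delta_tilde smul x / 14 \<le> wck smul A"
  proof (rule dense_ge)
    fix r assume r: "wck smul A < r"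
    then have "0 < r" using wck_nonneg[OF A] by simp
    then obtain s where "strict_mono s" "delta smul (x \<circ> s) \<le> 14 * r"
      using delta_subseq_le[OF A(1) x r] by blast
    with delta_tilde_le[OF bx] show "delta_tilde smul x / 14 \<le> r" by fastforce
  qed
  then show "delta_tilde smul x \<le> 14 * wck smul A" by simp
qed

end

section \<open>Equivalence of the quantities and the Schur property\<close>

lemma dominated_by_trans:
  assumes "dominated_by p q" "dominated_by q r"
  shows "dominated_by p r"
proof -
  obtain C where C: "C \<ge> 0 \<and> (\<forall>A. A \<noteq> {} \<and> bounded A \<longrightarrow> p A \<le> C * q A)"
    using assms(1) unfolding dominated_by_def ..
  obtain D where D: "D \<ge> 0 \<and> (\<forall>A. A \<noteq> {} \<and> bounded A \<longrightarrow> q A \<le> D * r A)"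
    using assms(2) unfolding dominated_by_def ..
  have "p A \<le> (C * D) * r A" if "A \<noteq> {} \<and> bounded A" for A
  proof -
    have "p A \<le> C * q A" using that C by simp
    also have "\<dots> \<le> C * (D * r A)" using that C D by (intro mult_left_mono) simp_all
    finally show ?thesis by (simp add: mult.assoc)
  qed
  then show ?thesis unfolding dominated_by_def using C D by (intro exI[of _ "C * D"]) simp
qed

context norming_scaling
begin

text \<open>
  Cover the range by finitely many balls of radius \<open>r\<close>. Only the balls visited infinitely often
  matter for the oscillation. The distance of two of their centres is bounded, up to \<open>2 r\<close>, by
  the oscillation of a functional of norm one that norms the difference of the centres.
\<close>

lemma ca_le_delta_plus_chi:
  assumes x: "bounded (range x)"
  shows "ca x \<le> delta smul x + 4 * chi (range x)"
proof (rule dense_ge)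
  fix q assume q: "delta smul x + 4 * chi (range x) < q"
  define r where "r = (q - delta smul x) / 4"
  have "chi (range x) < r" using q by (simp add: r_def)
  from finite_cover_of_chi_less[OF x _ this]
  obtain F where F': "finite F" "\<forall>a\<in>range x. \<exists>p\<in>F. dist a p < r" by auto
  have F: "\<exists>p\<in>F. dist (x n) p < r" for n using F'(2) by simp
  define P where "P = {p\<in>F. \<exists>\<^sub>F n in sequentially. dist (x n) p < r}"
  have "\<forall>\<^sub>F n in sequentially. \<forall>p\<in>F - P. \<not> dist (x n) p < r"
    using F'(1) by (intro eventually_ball_finite) (auto simp: P_def not_frequently)
  then obtain N where N: "\<And>n p. n \<ge> N \<Longrightarrow> p \<in> F - P \<Longrightarrow> \<not> dist (x n) p < r"
    unfolding eventually_sequentially by blast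
  have close: "norm (p - p') \<le> delta smul x + 2 * r" if p: "p \<in> P" and p': "p' \<in> P" for p p'
  proof -
    obtain u where u: "linear u" "\<And>v. \<bar>u v\<bar> \<le> norm v" "u (p - p') = norm (p - p')"
      using Hahn_Banach_norming[of "p - p'"] by auto
    obtain g where g: "g \<in> dual_ball smul" "\<And>v. \<bar>u v\<bar> \<le> norm (g v)"
      using real_functional_dominated[OF u(1,2)] by blast
    have "norm (p - p') - 2 * r \<le> ca (\<lambda>n. g (x n))"
    proof (rule ca_ge[OF bounded_dual_image[OF g(1) x]])
      fix n
      obtain i where i: "i \<ge> n" "dist (x i) p < r"
        using p by (auto simp: P_def frequently_sequentially)
      obtain j where j: "j \<ge> n" "dist (x j) p' < r"
        using p' by (auto simp: P_def frequently_sequentially)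
      have "norm (p - p') = u (x i - x j) - u (x i - p) + u (x j - p')"
        using u(3) by (simp add: linear_diff[OF u(1)])
      also have "\<dots> \<le> norm (g (x i - x j)) + 2 * r"
        using g(2)[of "x i - x j"] u(2)[of "x i - p"] u(2)[of "x j - p'"] i(2) j(2)
        by (simp add: dist_norm)
      finally have "norm (p - p') - 2 * r \<le> dist (g (x i)) (g (x j))"
        using dual_ballD(4)[OF g(1)] by (simp add: dist_norm)
      with i(1) j(1) show "\<exists>i\<ge>n. \<exists>j\<ge>n. norm (p - p') - 2 * r \<le> dist (g (x i)) (g (x j))" by blast
    qed
    also have "\<dots> \<le> delta smul x" using ca_le_delta[OF x g(1)] .
    finally show ?thesis by simp
  qed
  show "ca x \<le> q"
  proof (rule ca_le[OF x])
    fix i j assume ij: "i \<ge> N" "j \<ge> N"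
    obtain p where p: "p \<in> P" "dist (x i) p < r" using F[of i] N[OF ij(1)] by blast
    obtain p' where p': "p' \<in> P" "dist (x j) p' < r" using F[of j] N[OF ij(2)] by blast
    have "dist (x i) (x j) \<le> dist (x i) p + dist p p' + dist p' (x j)"
      by (meson dist_triangle order_trans add_right_mono)
    also have "\<dots> \<le> delta smul x + 4 * r"
      using close[OF p(1) p'(1)] p(2) p'(2) by (simp add: dist_norm norm_minus_commute)
    also have "\<dots> = q" by (simp add: r_def diff_divide_distrib)
    finally show "dist (x i) (x j) \<le> q" .
  qed
qed

theorem pairwise_equivalent_iff_quantitative_Schur:
  "pairwise_equivalent {beta_w smul, wck smul, omega smul, chi} \<longleftrightarrow> quantitative_Schur smul"
proof
  assume "pairwise_equivalent {beta_w smul, wck smul, omega smul, chi}"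
  then have "dominated_by chi (beta_w smul)"
    by (auto simp: pairwise_equivalent_def equivalent_quantities_def)
  then obtain C where C: "C \<ge> 0 \<and> (\<forall>A. A \<noteq> {} \<and> bounded A \<longrightarrow> chi A \<le> C * beta_w smul A)"
    unfolding dominated_by_def ..
  have "c_Schur smul (1 + 4 * C)"
    unfolding c_Schur_def
  proof (intro allI impI)
    fix x :: "nat \<Rightarrow> 'a" assume x: "bounded (range x)"
    have "chi (range x) \<le> C * beta_w smul (range x)" using C x by simp
    also have "\<dots> \<le> C * delta smul x"
      using beta_w_range_le_delta[OF x] C by (intro mult_left_mono) simp_all
    finally show "ca x \<le> (1 + 4 * C) * delta smul x"
      using ca_le_delta_plus_chi[OF x] by (simp add: algebra_simps)
  qed
  with C show "quantitative_Schur smul" unfolding quantitative_Schur_def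
    by (intro exI[of _ "1 + 4 * C"]) simp
next
  assume "quantitative_Schur smul"
  then obtain c' where c': "c' \<ge> 0" "c_Schur smul c'" unfolding quantitative_Schur_def by blast
  \<comment> \<open>A positive constant is needed for dividing by it.\<close>
  define c where "c = c' + 1"
  have c: "c > 0" using c' by (simp add: c_def)
  have "c_Schur smul c"
    unfolding c_Schur_def
  proof (intro allI impI)
    fix x :: "nat \<Rightarrow> 'a" assume x: "bounded (range x)"
    have "ca x \<le> c' * delta smul x" using c'(2) x by (simp add: c_Schur_def)
    then show "ca x \<le> c * delta smul x" using delta_nonneg[OF x] by (simp add: c_def algebra_simps)
  qed
  note chi = chi_le_beta_w[OF this c]
  have wo: "dominated_by (wck smul) (omega smul)"
    unfolding dominated_by_def using wck_le_omega by (intro exI[of _ 1]) simp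
  have oc: "dominated_by (omega smul) chi"
    unfolding dominated_by_def using omega_le_chi by (intro exI[of _ 1]) simp
  have cb: "dominated_by chi (beta_w smul)"
    unfolding dominated_by_def using c chi by (intro exI[of _ c]) simp
  have bw: "dominated_by (beta_w smul) (wck smul)"
    unfolding dominated_by_def using beta_w_le_wck by (intro exI[of _ 14]) simp
  note wc = dominated_by_trans[OF wo oc] and ob = dominated_by_trans[OF oc cb]
    and cw = dominated_by_trans[OF cb bw] and bo = dominated_by_trans[OF bw wo]
  note wb = dominated_by_trans[OF wc cb] and ow = dominated_by_trans[OF ob bw]
    and co = dominated_by_trans[OF cw wo] and bc = dominated_by_trans[OF bo oc]
  note ww = dominated_by_trans[OF wb bw] and oo = dominated_by_trans[OF ow wo]
    and cc = dominated_by_trans[OF co oc] and bb = dominated_by_trans[OF bc cb]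
  show "pairwise_equivalent {beta_w smul, wck smul, omega smul, chi}"
    unfolding pairwise_equivalent_def equivalent_quantities_def
    by (simp add: wo oc cb bw wc ob cw bo wb ow co bc ww oo cc bb)
qed

end

section \<open>Real and complex scalars\<close>

lemma norming_scaling_real: "norming_scaling (scaleR :: real \<Rightarrow> 'a::banach \<Rightarrow> 'a)"
proof -
  interpret normed_scaling "scaleR :: real \<Rightarrow> 'a \<Rightarrow> 'a" by (rule normed_scaling_scaleR)
  show ?thesis
  proof unfold_locales
    fix u :: "'a \<Rightarrow> real" assume u: "linear u" "\<And>x. \<bar>u x\<bar> \<le> norm x"
    then have "u \<in> dual_ball scaleR" by (intro dual_ballI) (auto simp: linear_cmul)
    then show "\<exists>g\<in>dual_ball scaleR. \<forall>x. \<bar>u x\<bar> \<le> norm (g x)" by auto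
  qed
qed

lemma norming_scaling_complex:
  fixes smul :: "complex \<Rightarrow> 'a::banach \<Rightarrow> 'a"
  assumes "normed_scaling smul"
  shows "norming_scaling smul"
proof -
  interpret normed_scaling smul by fact
  show ?thesis
  proof unfold_locales
    fix u :: "'a \<Rightarrow> real" assume u: "linear u" "\<And>x. \<bar>u x\<bar> \<le> norm x"
    \<comment> \<open>The complex-linear functional with real part \<open>u\<close>.\<close>
    define g where "g = (\<lambda>x. Complex (u x) (- u (smul \<i> x)))"
    have real: "smul (of_real r) x = r *\<^sub>R x" for r x by (rule smul_of_real)
    have ug: "u (smul c x) = Re c * u x + Im c * u (smul \<i> x)" for c x
    proof -
      have "smul c x = smul (of_real (Re c) + of_real (Im c) * \<i>) x"
        by (simp add: complex_eq mult.commute)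
      also have "\<dots> = Re c *\<^sub>R x + Im c *\<^sub>R smul \<i> x"
        by (simp add: scale_left_distrib real flip: scale_scale)
      finally show ?thesis by (simp add: linear_add[OF u(1)] linear_cmul[OF u(1)])
    qed
    have hom: "g (smul c x) = c * g x" for c x
    proof -
      have "u (smul \<i> (smul c x)) = Re (\<i> * c) * u x + Im (\<i> * c) * u (smul \<i> x)"
        using ug[of "\<i> * c" x] by simp
      then show ?thesis using ug[of c x] by (simp add: g_def complex_eq_iff)
    qed
    have lin: "linear g"
    proof (rule linearI)
      show "g (x + y) = g x + g y" for x y
        by (simp add: g_def complex_eq_iff scale_right_distrib linear_add[OF u(1)])
      show "g (r *\<^sub>R x) = r *\<^sub>R g x" for r x
        using hom[of "of_real r" x] by (simp add: real scaleR_conv_of_real)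
    qed
    have le: "norm (g x) \<le> norm x" for x
    proof (cases "g x = 0")
      case False
      \<comment> \<open>Rotating \<open>x\<close> by \<open>c\<close> makes \<open>g x\<close> real and nonnegative, and there \<open>g\<close> agrees with \<open>u\<close>.\<close>
      define c where "c = cnj (sgn (g x))"
      have nc: "norm c = 1" using False by (simp add: c_def norm_sgn)
      have "c * g x = of_real (norm (g x))"
        using False by (simp add: c_def sgn_eq mult.commute[of "cnj _"] complex_norm_square[symmetric] power2_eq_square)
      then have "norm (g x) = Re (g (smul c x))" by (simp add: hom)
      also have "\<dots> = u (smul c x)" by (simp add: g_def)
      also have "\<dots> \<le> norm (smul c x)" using u(2)[of "smul c x"] by simp
      also have "\<dots> = norm x" by (simp add: norm_smul nc)
      finally show ?thesis .
    qed simp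
    have "\<bar>u x\<bar> \<le> norm (g x)" for x using abs_Re_le_cmod[of "g x"] by (simp add: g_def)
    then show "\<exists>g\<in>dual_ball smul. \<forall>x. \<bar>u x\<bar> \<le> norm (g x)"
      using dual_ballI[OF lin hom le] by blast
  qed
qed

theorem corollary5p3:
  shows "(let smul = (scaleR :: real \<Rightarrow> 'a::banach \<Rightarrow> 'a) in
            pairwise_equivalent {beta_w smul, wck smul, omega smul, chi}
              \<longleftrightarrow> quantitative_Schur smul)
       \<and> (\<forall>smul :: complex \<Rightarrow> 'b::banach \<Rightarrow> 'b. normed_scaling smul \<longrightarrow>
            (pairwise_equivalent {beta_w smul, wck smul, omega smul, chi}
              \<longleftrightarrow> quantitative_Schur smul))"
  unfolding Let_def
  using norming_scaling.pairwise_equivalent_iff_quantitative_Schur[OF norming_scaling_real]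
    norming_scaling.pairwise_equivalent_iff_quantitative_Schur[OF norming_scaling_complex]
  by blast

end
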